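(* Let $k\ge4$ be even. Suppose there is a function $r\colon\mathbb{Z}_{\ge1}\to\mathbb{Z}_{\ge1}$ with $\log r(N)/\log N\to0$ as $N\to\infty$ such that for every $N$ there is a coloring of $[N]=\{1,\dots,N\}$ with $r(N)$ colors containing no symmetrically colored $k$-AP. Then for every $C>0$, $\rho_k(\alpha)<\alpha^C$ for all sufficiently small $\alpha>0$.
   Context: For even $k$, a $k$-AP $n,n+d,\dots,n+(k-1)d$ with $d\ne0$ is symmetrically colored if $n+(i-1)d$ and $n+(k-i)d$ have the same color for every $i=1,\dots,k/2$. For a finite abelian group $G$ and $f\colon G\to\mathbb{C}$, $\partial_hf(n)=f(n)\overline{f(n-h)}$ and $\|f\|_{U^s}^{2^s}=\mathbb{E}_{n,h_1,\dots,h_s}\partial_{h_1}\cdots\partial_{h_s}f(n)$. $\Lambda_k(f)=\mathbb{E}_{n,d}f(n)f(n+d)\cdots f(n+(k-1)d)$. For $0<\alpha<1$, $\rho_k(\alpha)$ is the largest real number such that for every $\epsilon>0$ there exist $\eta>0$ and $N_0$ such that whenever $N\ge N_0$ and $A\subset\mathbb{Z}/N\mathbb{Z}$ satisfies $\|1_A-\alpha\|_{U^{k-2}}\le\eta$, then $\Lambda_k(1_A)\ge\rho_k(\alpha)-\epsilon$. *)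

theory Defs
  imports Complex_Main "HOL-Library.FuncSet" "HOL-Library.Indicator_Function" "HOL-Algebra.Elementary_Groups"
begin

text \<open>
  Finite abelian groups are HOL-Algebra groups in multiplicative notation, so \<open>n - h\<close> is written
  \<open>n \<otimes> inv h\<close> and \<open>n + i d\<close> is written \<open>n \<otimes> d [^] i\<close>. The group \<open>\<int>/N\<int>\<close> is
  \<^term>\<open>integer_mod_group N\<close>, with carrier \<open>{0..<int N}\<close> for \<open>N \<ge> 1\<close>.
\<close>

definition average :: "'a set \<Rightarrow> ('a \<Rightarrow> complex) \<Rightarrow> complex" where
  "average S F = (\<Sum>x\<in>S. F x) / of_nat (card S)"

definition mult_deriv :: "('a, 'b) monoid_scheme \<Rightarrow> 'a \<Rightarrow> ('a \<Rightarrow> complex) \<Rightarrow> 'a \<Rightarrow> complex" where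
  "mult_deriv G h f = (\<lambda>n. f n * cnj (f (n \<otimes>\<^bsub>G\<^esub> inv\<^bsub>G\<^esub> h)))"

text \<open>
  A list \<open>[h\<^sub>1, \<dots>, h\<^sub>s]\<close> holds the shifts. For \<open>s \<ge> 1\<close> the average below is a nonnegative real
  number, so \<^const>\<open>Re\<close> discards nothing and the norm is its nonnegative \<open>2^s\<close>-th root.
\<close>

definition gowers_average :: "('a, 'b) monoid_scheme \<Rightarrow> nat \<Rightarrow> ('a \<Rightarrow> complex) \<Rightarrow> complex" where
  "gowers_average G s f =
     average (carrier G \<times> {hs. set hs \<subseteq> carrier G \<and> length hs = s})
       (\<lambda>(n, hs). foldr (mult_deriv G) hs f n)"

definition gowers_norm :: "('a, 'b) monoid_scheme \<Rightarrow> nat \<Rightarrow> ('a \<Rightarrow> complex) \<Rightarrow> real" where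
  "gowers_norm G s f = root (2 ^ s) (Re (gowers_average G s f))"

definition AP_average :: "('a, 'b) monoid_scheme \<Rightarrow> nat \<Rightarrow> ('a \<Rightarrow> complex) \<Rightarrow> complex" where
  "AP_average G k f =
     average (carrier G \<times> carrier G) (\<lambda>(n, d). \<Prod>i<k. f (n \<otimes>\<^bsub>G\<^esub> d [^]\<^bsub>G\<^esub> i))"

text \<open>
  \<open>AP_average\<close> of an indicator function is a real number, so \<^const>\<open>Re\<close> only changes the type.
\<close>

definition AP_lower_bound :: "nat \<Rightarrow> real \<Rightarrow> real \<Rightarrow> bool" where
  "AP_lower_bound k \<alpha> \<rho> \<longleftrightarrow>
     (\<forall>\<epsilon>>0. \<exists>\<eta>>0. \<exists>N\<^sub>0. \<forall>N\<ge>N\<^sub>0. N \<ge> 1 \<longrightarrow>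
        (\<forall>A \<subseteq> carrier (integer_mod_group N).
           gowers_norm (integer_mod_group N) (k - 2)
             (\<lambda>n. indicator A n - complex_of_real \<alpha>) \<le> \<eta> \<longrightarrow>
           Re (AP_average (integer_mod_group N) k (indicator A)) \<ge> \<rho> - \<epsilon>))"

definition rho :: "nat \<Rightarrow> real \<Rightarrow> real" where
  "rho k \<alpha> = (GREATEST \<rho>. AP_lower_bound k \<alpha> \<rho>)"

definition sym_colored_AP :: "nat \<Rightarrow> (int \<Rightarrow> 'c) \<Rightarrow> int \<Rightarrow> int \<Rightarrow> bool" where
  "sym_colored_AP k c n d \<longleftrightarrow> d \<noteq> 0 \<and>
     (\<forall>i\<in>{1..k div 2}. c (n + (int i - 1) * d) = c (n + (int k - int i) * d))"

definition contains_sym_colored_AP :: "nat \<Rightarrow> nat \<Rightarrow> (int \<Rightarrow> 'c) \<Rightarrow> bool" where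
  "contains_sym_colored_AP k N c \<longleftrightarrow>
     (\<exists>n d. (\<forall>i<k. n + int i * d \<in> {1..int N}) \<and> sym_colored_AP k c n d)"

end

theory Submission
  imports Defs "HOL-Analysis.Complex_Transcendental" "HOL-Computational_Algebra.Primes" "HOL-Real_Asymp.Real_Asymp"
begin

text \<open>
  Let \<open>M = q ^ D\<close> be a little larger than \<open>\<alpha> powr - C\<close> and let \<open>N = M p\<close> with \<open>p\<close> a large prime. Take \<open>A\<close> to
  be the set of all \<open>n\<close> such that \<open>n ^ (k - 2) mod p\<close> lies in an interval of length \<open>\<alpha> p\<close> whose position
  depends on a color of \<open>n mod M\<close>. Expanding the intervals into additive characters mod \<open>p\<close> reduces
  \<open>1\<^sub>A - \<alpha>\<close> to phases of degree \<open>k - 2\<close>, whose \<open>U^(k-2)\<close> norms are small; hence \<open>A\<close> is uniform.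

  The values of \<open>n ^ (k - 2)\<close> along a \<open>k\<close>-AP satisfy the linear relation with coefficients
  \<open>(-1)^i (k-1 choose i)\<close>. If the positions of the intervals are generic, a \<open>k\<close>-AP in \<open>A\<close> forces these
  coefficients to sum to zero over every color class. A Behrend type coloring by sums of squares of
  base \<open>q\<close> digits makes every color class have at most two elements; a class of two elements with zero
  sum is \<open>{i, k - 1 - i}\<close>, so the progression is symmetrically colored mod \<open>M\<close>. By hypothesis this
  happens only if \<open>M\<close> divides the common difference, so that \<open>A\<close> has \<open>k\<close>-AP density at most \<open>1 / M\<close>.
  Only \<open>M powr o(1)\<close> colors are used, which leaves room for the generic positions.
\<close>

section \<open>A Cauchy--Schwarz inequality for Gowers averages\<close>

lemma average_cong: "(\<And>x. x \<in> S \<Longrightarrow> F x = H x) \<Longrightarrow> average S F = average S H"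
  unfolding average_def by (simp cong: sum.cong)

lemma average_Times:
  "average (A \<times> B) F = average A (\<lambda>a. average B (\<lambda>b. F (a, b)))"
  unfolding average_def by (simp add: sum.cartesian_product card_cartesian_product flip: sum_divide_distrib)

lemma average_swap:
  "average A (\<lambda>a. average B (\<lambda>b. F a b)) = average B (\<lambda>b. average A (\<lambda>a. F a b))"
  using sum.swap[of F B A]
  by (simp add: average_def mult.commute flip: sum_divide_distrib)

lemma average_add: "average S (\<lambda>x. F x + H x) = average S F + average S H"
  unfolding average_def by (simp add: sum.distrib add_divide_distrib)

lemma average_mult_left: "average S (\<lambda>x. c * F x) = c * average S F"
  unfolding average_def by (simp flip: sum_distrib_left)

lemma average_mult_right: "average S (\<lambda>x. F x * c) = average S F * c"
  unfolding average_def by (simp flip: sum_distrib_right)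

lemma average_sum: "average S (\<lambda>x. \<Sum>i\<in>I. F i x) = (\<Sum>i\<in>I. average S (F i))"
  unfolding average_def by (simp add: sum.swap[of _ S I] sum_divide_distrib)

lemma average_cnj: "cnj (average S F) = average S (\<lambda>x. cnj (F x))"
  unfolding average_def by simp

lemma average_reindex: "bij_betw h S T \<Longrightarrow> average S (\<lambda>x. F (h x)) = average T F"
  unfolding average_def by (simp add: sum.reindex_bij_betw bij_betw_same_card)

lemma average_of_real:
  "average S (\<lambda>x. complex_of_real (F x)) = complex_of_real ((\<Sum>x\<in>S. F x) / real (card S))"
  unfolding average_def by simp

lemma norm_average_le:
  assumes "finite S" "S \<noteq> {}" "\<And>x. x \<in> S \<Longrightarrow> norm (F x) \<le> G x"
  shows "norm (average S F) \<le> (\<Sum>x\<in>S. G x) / card S"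
  using assms unfolding average_def
  by (auto simp: norm_divide intro!: divide_right_mono sum_norm_le)

lemma norm_average_le_const:
  assumes "finite S" "S \<noteq> {}" "\<And>x. x \<in> S \<Longrightarrow> norm (F x) \<le> c"
  shows "norm (average S F) \<le> c"
  using norm_average_le[OF assms(1,2), of F "\<lambda>_. c"] assms by (auto simp: sum_constant)

text \<open>The triangle inequality discards the bounded factor \<open>H\<close>; what remains is
  Cauchy-Schwarz, the square of a mean being at most the mean of the squares.\<close>

lemma norm_average_squared_le:
  assumes "finite S" "\<And>x. x \<in> S \<Longrightarrow> norm (H x) \<le> 1"
  shows "(norm (average S (\<lambda>x. F x * H x)))\<^sup>2 \<le> Re (average S (\<lambda>x. F x * cnj (F x)))"
proof (cases "S = {}")
  case False
  have "norm (average S (\<lambda>x. F x * H x)) \<le> (\<Sum>x\<in>S. norm (F x)) / card S"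
    by (rule norm_average_le) (use assms False in \<open>auto simp: norm_mult intro: mult_right_le_one_le\<close>)
  then have "(norm (average S (\<lambda>x. F x * H x)))\<^sup>2 \<le> ((\<Sum>x\<in>S. norm (F x)) / card S)\<^sup>2"
    by (intro power_mono) auto
  also have "\<dots> \<le> (\<Sum>x\<in>S. (norm (F x))\<^sup>2) / card S"
    using sum_squared_le_sum_of_squares[of "\<lambda>x. norm (F x)" S] False assms(1)
    by (simp add: power_divide divide_simps power2_eq_square mult_ac)
  also have "\<dots> = Re (average S (\<lambda>x. F x * cnj (F x)))"

    by (simp add: average_of_real del: of_real_power flip: complex_norm_square)
  finally show ?thesis .
qed (simp add: average_def)

text \<open>Convexity of the power \<open>2 ^ s\<close>, by repeating the same inequality
  \<open>s\<close> times.\<close>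

lemma norm_average_power_le:
  assumes "finite S"
  shows "(norm (average S F)) ^ 2 ^ s \<le> (\<Sum>x\<in>S. norm (F x) ^ 2 ^ s) / card S"
proof (induction s)
  case 0
  then show ?case
    using assms norm_average_le[of S F "\<lambda>x. norm (F x)"] by (cases "S = {}") (auto simp: average_def)
next
  case (Suc s)
  have "norm (average S F) ^ 2 ^ Suc s = (norm (average S F) ^ 2 ^ s)\<^sup>2"
    by (simp add: power_mult[symmetric] mult.commute)
  also have "\<dots> \<le> ((\<Sum>x\<in>S. norm (F x) ^ 2 ^ s) / card S)\<^sup>2"
    by (intro power_mono Suc) auto
  also have "\<dots> \<le> (\<Sum>x\<in>S. (norm (F x) ^ 2 ^ s)\<^sup>2) / card S"
    using sum_squared_le_sum_of_squares[of "\<lambda>x. norm (F x) ^ 2 ^ s" S] assms(1)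
    by (cases "S = {}") (auto simp: power_divide divide_simps power2_eq_square mult_ac)
  also have "\<dots> = (\<Sum>x\<in>S. norm (F x) ^ 2 ^ Suc s) / card S"
    by (simp add: power_mult[symmetric] mult.commute)
  finally show ?case .
qed

abbreviation shifts :: "('a, 'b) monoid_scheme \<Rightarrow> nat \<Rightarrow> 'a list set" where
  "shifts G s \<equiv> {hs. set hs \<subseteq> carrier G \<and> length hs = s}"

lemma shifts_nonempty: "carrier G \<noteq> {} \<Longrightarrow> shifts G s \<noteq> {}"
  by (auto intro!: exI[of _ "replicate s (SOME x. x \<in> carrier G)"] simp: some_in_eq)

text \<open>Both ends of the list of shifts are needed: \<open>dual_weight\<close> recurses on the
  first shift, whereas \<open>foldr\<close> applies the last shift to \<open>f\<close> first, so
  that \<open>gowers_average\<close> recurses on the last.\<close>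

lemma average_shifts_Cons:
  "average (shifts G (Suc s)) F = average (carrier G) (\<lambda>h. average (shifts G s) (\<lambda>hs. F (h # hs)))"
proof -
  have "bij_betw (\<lambda>(h, hs). h # hs) (carrier G \<times> shifts G s) (shifts G (Suc s))"
    by (auto simp: bij_betw_def inj_on_def image_iff length_Suc_conv)
  from average_reindex[OF this, of F] show ?thesis
    by (simp add: average_Times case_prod_unfold)
qed

lemma average_shifts_snoc:
  "average (shifts G (Suc s)) F = average (carrier G) (\<lambda>h. average (shifts G s) (\<lambda>hs. F (hs @ [h])))"
proof -
  have "bij_betw (\<lambda>(h, hs). hs @ [h]) (carrier G \<times> shifts G s) (shifts G (Suc s))"
    by (auto simp: bij_betw_def inj_on_def image_iff length_Suc_conv_rev)
  from average_reindex[OF this, of F] show ?thesis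
    by (simp add: average_Times case_prod_unfold)
qed

lemma gowers_average_0: "gowers_average G 0 f = average (carrier G) f"
proof -
  have "shifts G 0 = {[]}" by auto
  then show ?thesis
    unfolding gowers_average_def average_Times by (simp add: average_def)
qed

lemma gowers_average_Suc:
  "gowers_average G (Suc s) f = average (carrier G) (\<lambda>h. gowers_average G s (mult_deriv G h f))"
  unfolding gowers_average_def average_Times
  by (subst average_swap) (simp add: average_shifts_snoc average_swap[of "shifts G s"])

context comm_group
begin

lemma average_reflect_shift:
  assumes "n \<in> carrier G"
  shows "average (carrier G) (\<lambda>h. F (n \<otimes> inv h)) = average (carrier G) F"
proof (rule average_reindex, rule bij_betw_byWitness[where f' = "\<lambda>m. inv m \<otimes> n"])
  show "\<forall>a\<in>carrier G. inv (n \<otimes> inv a) \<otimes> n = a"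
    using assms by (auto simp: inv_mult_group m_assoc)
  show "\<forall>a\<in>carrier G. n \<otimes> inv (inv a \<otimes> n) = a"
    using assms by (auto simp: inv_mult_group m_assoc[symmetric])
qed (use assms in auto)

lemma average_convolve:
  "average (carrier G) (\<lambda>h. average (carrier G) (\<lambda>n. F n * H (n \<otimes> inv h)))
    = average (carrier G) F * average (carrier G) H"
  by (subst average_swap)
     (simp add: average_mult_left average_mult_right average_reflect_shift cong: average_cong)

lemma mult_deriv_mult:
  "mult_deriv G h (\<lambda>n. F n * H n) n = mult_deriv G h F n * mult_deriv G h H n"
  by (simp add: mult_deriv_def)

text \<open>A squared mean is an average of derivatives. This drives the induction on the number of
  shifts.\<close>

lemma average_mult_cnj:
  "average (carrier G) F * cnj (average (carrier G) F)
    = average (carrier G) (\<lambda>h. average (carrier G) (mult_deriv G h F))"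
  using average_convolve[of F "\<lambda>n. cnj (F n)"] by (simp add: mult_deriv_def average_cnj)

end

text \<open>
  \<open>w n hs\<close> stands for the product of the factors at all vertices of the cube \<open>n - \<omega> \<cdot> hs\<close> other than the
  vertex \<open>n\<close> itself: the weight \<open>u\<close> collects the vertices not using the first shift, \<open>v\<close> the others.
\<close>

fun dual_weight :: "('a, 'b) monoid_scheme \<Rightarrow> nat \<Rightarrow> ('a \<Rightarrow> 'a list \<Rightarrow> complex) \<Rightarrow> bool" where
  "dual_weight G 0 w \<longleftrightarrow> (\<forall>n\<in>carrier G. w n [] = 1)"
| "dual_weight G (Suc s) w \<longleftrightarrow> (\<exists>u v. dual_weight G s u \<and> (\<forall>n hs. norm (v n hs) \<le> 1) \<and>
     (\<forall>n\<in>carrier G. \<forall>h\<in>carrier G. \<forall>hs\<in>shifts G s. w n (h # hs) = u n hs * v (n \<otimes>\<^bsub>G\<^esub> inv\<^bsub>G\<^esub> h) hs))"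

lemma dual_weight_SucE:
  assumes "dual_weight G (Suc s) w"
  obtains u v where "dual_weight G s u" "\<And>n hs. norm (v n hs) \<le> 1"
    "\<And>n h hs. n \<in> carrier G \<Longrightarrow> h \<in> carrier G \<Longrightarrow> hs \<in> shifts G s \<Longrightarrow>
       w n (h # hs) = u n hs * v (n \<otimes>\<^bsub>G\<^esub> inv\<^bsub>G\<^esub> h) hs"
proof -
  from assms obtain u v where u: "dual_weight G s u" and v: "\<forall>n hs. norm (v n hs) \<le> 1"
    and w: "\<forall>n\<in>carrier G. \<forall>h\<in>carrier G. \<forall>hs\<in>shifts G s.
       w n (h # hs) = u n hs * v (n \<otimes>\<^bsub>G\<^esub> inv\<^bsub>G\<^esub> h) hs"
    unfolding dual_weight.simps by (elim exE conjE)
  show thesis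
  proof (rule that[OF u])
    show "norm (v n hs) \<le> 1" for n hs using v by blast
    show "w n (h # hs) = u n hs * v (n \<otimes>\<^bsub>G\<^esub> inv\<^bsub>G\<^esub> h) hs"
      if "n \<in> carrier G" "h \<in> carrier G" "hs \<in> shifts G s" for n h hs
      using w that by blast
  qed
qed

context comm_group
begin

text \<open>A Cauchy-Schwarz step returns the weight \<open>u\<close> differentiated in the base
  point. Since shifts commute, the derivative splits again into a part without the first shift and a
  part evaluated at \<open>n - h\<close>.\<close>

lemma dual_weight_mult_deriv:
  assumes "dual_weight G s w" "h \<in> carrier G"
  shows "dual_weight G s (\<lambda>n hs. mult_deriv G h (\<lambda>m. w m hs) n)"
  using assms(1)
proof (induction s arbitrary: w)
  case 0
  then show ?case using assms(2) by (simp add: mult_deriv_def)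
next
  case (Suc s)
  obtain u v where uv: "dual_weight G s u" "\<And>n hs. norm (v n hs) \<le> 1"
    "\<And>n h hs. n \<in> carrier G \<Longrightarrow> h \<in> carrier G \<Longrightarrow> hs \<in> shifts G s \<Longrightarrow>
       w n (h # hs) = u n hs * v (n \<otimes> inv h) hs"
    using dual_weight_SucE[OF Suc.prems] by blast
  have comm: "n \<otimes> inv h \<otimes> inv h' = n \<otimes> inv h' \<otimes> inv h" if "n \<in> carrier G" "h' \<in> carrier G" for n h'
    using that assms(2) by (simp add: m_ac)
  have "norm (mult_deriv G h (\<lambda>m. v m hs) n) \<le> 1" for n hs
    using uv(2) by (simp add: mult_deriv_def norm_mult mult_le_one)
  moreover have "mult_deriv G h (\<lambda>m. w m (h' # hs)) n =
      mult_deriv G h (\<lambda>m. u m hs) n * mult_deriv G h (\<lambda>m. v m hs) (n \<otimes> inv h')"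
    if "n \<in> carrier G" "h' \<in> carrier G" "hs \<in> shifts G s" for n h' hs
    using that assms(2) uv(3) comm by (simp add: mult_deriv_def)
  ultimately show ?case
    unfolding dual_weight.simps using Suc.IH[OF uv(1)]
    by (intro exI[of "\<lambda>u. \<exists>v. _ u v" "\<lambda>n hs. mult_deriv G h (\<lambda>m. u m hs) n"]
        exI[of "\<lambda>v. _ \<and> _ v" "\<lambda>n hs. mult_deriv G h (\<lambda>m. v m hs) n"] conjI allI ballI)
qed

text \<open>Induction on \<open>s\<close>. Averaging over the first shift splits off the bounded
  factor \<open>v\<close>, Cauchy-Schwarz over the other shifts removes it, and the square of what
  is left is an average of correlations of the same kind for the derivatives of \<open>f\<close> and
  \<open>u\<close>. The induction starts at 1 because for \<open>s = 0\<close> the right-hand side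
  is only the real part of a mean.\<close>

lemma gowers_Cauchy_Schwarz:
  assumes "finite (carrier G)" "dual_weight G s w" "s \<ge> 1"
  shows "norm (average (carrier G) (\<lambda>n. average (shifts G s) (\<lambda>hs. f n * w n hs))) ^ 2 ^ s
           \<le> Re (gowers_average G s f)"
  using assms(3,2)
proof (induction s arbitrary: w f rule: dec_induct)
  case base
  have shifts_0: "shifts G 0 = {[]}" by auto
  obtain u v where "dual_weight G 0 u" and v: "\<And>n hs. norm (v n hs) \<le> 1"
    and w: "\<And>n h hs. n \<in> carrier G \<Longrightarrow> h \<in> carrier G \<Longrightarrow> hs \<in> shifts G 0 \<Longrightarrow>
       w n (h # hs) = u n hs * v (n \<otimes> inv h) hs"
    using dual_weight_SucE[OF base[unfolded One_nat_def]] by blast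
  then have uv: "\<And>n h. n \<in> carrier G \<Longrightarrow> h \<in> carrier G \<Longrightarrow> w n [h] = v (n \<otimes> inv h) []"
    unfolding shifts_0 by simp
  have "average (carrier G) (\<lambda>n. average (shifts G 1) (\<lambda>hs. f n * w n hs))
      = average (carrier G) (\<lambda>h. average (carrier G) (\<lambda>n. f n * v (n \<otimes> inv h) []))"
    unfolding One_nat_def average_shifts_Cons unfolding shifts_0
    by (subst average_swap) (simp add: uv average_def[of "{_}"] cong: average_cong)
  also have "\<dots> = average (carrier G) f * average (carrier G) (\<lambda>n. v n [])"
    by (rule average_convolve)
  finally have "norm (average (carrier G) (\<lambda>n. average (shifts G 1) (\<lambda>hs. f n * w n hs)))
     \<le> norm (average (carrier G) f)"
    using v assms(1) one_closed
    by (auto simp: norm_mult intro!: mult_right_le_one_le norm_average_le_const)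
  then have "norm (average (carrier G) (\<lambda>n. average (shifts G 1) (\<lambda>hs. f n * w n hs))) ^ 2 ^ 1
     \<le> (norm (average (carrier G) f))\<^sup>2"
    by (simp add: power_mono)
  also have "\<dots> = Re (average (carrier G) f * cnj (average (carrier G) f))"
    by (simp del: of_real_power flip: complex_norm_square)
  also have "\<dots> = Re (gowers_average G 1 f)"
    unfolding average_mult_cnj One_nat_def gowers_average_Suc gowers_average_0 ..
  finally show ?case .
next
  case (step s)
  obtain u v where uv: "dual_weight G s u" "\<And>n hs. norm (v n hs) \<le> 1"
    "\<And>n h hs. n \<in> carrier G \<Longrightarrow> h \<in> carrier G \<Longrightarrow> hs \<in> shifts G s \<Longrightarrow>
       w n (h # hs) = u n hs * v (n \<otimes> inv h) hs"
    using dual_weight_SucE[OF step.prems] by blast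
  define X where "X = (\<lambda>hs. average (carrier G) (\<lambda>n. f n * u n hs))"
  define Y where "Y = (\<lambda>hs. average (carrier G) (\<lambda>n. v n hs))"
  define Z where "Z = (\<lambda>h. average (carrier G) (\<lambda>n. average (shifts G s)
     (\<lambda>hs. mult_deriv G h f n * mult_deriv G h (\<lambda>m. u m hs) n)))"
  have fin: "finite (shifts G s)" by (rule finite_lists_length_eq[OF assms(1)])
  have "average (carrier G) (\<lambda>n. average (shifts G (Suc s)) (\<lambda>hs. f n * w n hs))
      = average (carrier G) (\<lambda>n. average (carrier G) (\<lambda>h. average (shifts G s)
          (\<lambda>hs. (f n * u n hs) * v (n \<otimes> inv h) hs)))"
    by (auto simp: average_shifts_Cons uv(3) mult.assoc intro!: average_cong)
  also have "\<dots> = average (shifts G s) (\<lambda>hs. average (carrier G) (\<lambda>h. average (carrier G) (\<lambda>n.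
          (f n * u n hs) * v (n \<otimes> inv h) hs)))"
    by (subst average_swap, subst (2) average_swap, subst average_swap) simp
  \<comment> \<open>For fixed \<open>hs\<close> the factor \<open>v\<close> depends on
    \<open>n - h\<close> only, so the averages over \<open>n\<close> and \<open>h\<close>
    decouple.\<close>
  also have "\<dots> = average (shifts G s) (\<lambda>hs. X hs * Y hs)"
    unfolding X_def Y_def by (subst average_convolve) simp
  finally have eq: "average (carrier G) (\<lambda>n. average (shifts G (Suc s)) (\<lambda>hs. f n * w n hs))
      = average (shifts G s) (\<lambda>hs. X hs * Y hs)" .
  have "norm (Y hs) \<le> 1" for hs
    unfolding Y_def using uv(2) assms(1) one_closed by (intro norm_average_le_const) auto
  then have "(norm (average (shifts G s) (\<lambda>hs. X hs * Y hs)))\<^sup>2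
      \<le> Re (average (shifts G s) (\<lambda>hs. X hs * cnj (X hs)))"
    by (intro norm_average_squared_le fin)
  also have "average (shifts G s) (\<lambda>hs. X hs * cnj (X hs)) = average (carrier G) Z"
    unfolding X_def Z_def average_mult_cnj
    by (subst average_swap, rule average_cong, subst average_swap, intro average_cong)
       (simp add: mult_deriv_mult)
  also have "Re (average (carrier G) Z) \<le> norm (average (carrier G) Z)"
    by (rule complex_Re_le_cmod)
  \<comment> \<open>The Cauchy-Schwarz step used one squaring; the remaining power
    \<open>2 ^ s\<close> is moved inside the average over \<open>h\<close>, where the induction
    hypothesis applies to each derivative.\<close>
  finally have "norm (average (shifts G s) (\<lambda>hs. X hs * Y hs)) ^ 2 ^ Suc s
      \<le> norm (average (carrier G) Z) ^ 2 ^ s"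
    unfolding power_Suc power_mult by (rule power_mono) simp
  also have "\<dots> \<le> (\<Sum>h\<in>carrier G. norm (Z h) ^ 2 ^ s) / card (carrier G)"
    by (rule norm_average_power_le[OF assms(1)])
  also have "\<dots> \<le> (\<Sum>h\<in>carrier G. Re (gowers_average G s (mult_deriv G h f))) / card (carrier G)"
    unfolding Z_def
    by (intro divide_right_mono sum_mono step.IH dual_weight_mult_deriv uv(1)) auto
  also have "\<dots> = Re (gowers_average G (Suc s) f)"
    unfolding gowers_average_Suc by (simp add: average_def)
  finally show ?case unfolding eq .
qed

end

lemma norm_foldr_mult_deriv_le:
  assumes "\<And>n. norm (f n) \<le> 1"
  shows "norm (foldr (mult_deriv G) hs f n) \<le> 1"
proof (induction hs arbitrary: n)
  case (Cons h hs)
  then show ?case by (simp add: mult_deriv_def norm_mult mult_le_one)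
qed (use assms in simp)

text \<open>One factor \<open>f\<close> is kept at the vertex \<open>n\<close> and all others are
  frozen into a weight. The average is then linear in the kept factor, which may be expanded into
  phases term by term.\<close>

lemma gowers_average_dual_weight:
  assumes "\<And>n. norm (f n) \<le> 1"
  obtains w where "dual_weight G s w" "\<And>n hs. norm (w n hs) \<le> 1"
    "gowers_average G s f = average (carrier G) (\<lambda>n. average (shifts G s) (\<lambda>hs. f n * w n hs))"
proof -
  have "\<exists>w. dual_weight G s w \<and> (\<forall>n hs. norm (w n hs) \<le> 1) \<and>
      (\<forall>n. \<forall>hs\<in>shifts G s. foldr (mult_deriv G) hs f n = f n * w n hs)"
  proof (induction s)
    case 0
    then show ?case by (intro exI[of _ "\<lambda>_ _. 1"]) auto
  next
    case (Suc s)
    then obtain w where w: "dual_weight G s w" "\<And>n hs. norm (w n hs) \<le> 1"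
      "\<And>n hs. hs \<in> shifts G s \<Longrightarrow> foldr (mult_deriv G) hs f n = f n * w n hs" by auto
    \<comment> \<open>Differentiating once more multiplies by the conjugate of the whole previous
      product, taken at \<open>n - h\<close>.\<close>
    define v where "v = (\<lambda>n hs. cnj (foldr (mult_deriv G) hs f n))"
    have v: "norm (v n hs) \<le> 1" for n hs
      unfolding v_def using norm_foldr_mult_deriv_le[OF assms] by simp
    show ?case
    proof (intro exI[of _ "\<lambda>n hs. w n (tl hs) * v (n \<otimes>\<^bsub>G\<^esub> inv\<^bsub>G\<^esub> (hd hs)) (tl hs)"] conjI allI ballI)
      show "dual_weight G (Suc s) (\<lambda>n hs. w n (tl hs) * v (n \<otimes>\<^bsub>G\<^esub> inv\<^bsub>G\<^esub> (hd hs)) (tl hs))"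
        using w(1) v by auto
      show "norm (w n (tl hs) * v (n \<otimes>\<^bsub>G\<^esub> inv\<^bsub>G\<^esub> (hd hs)) (tl hs)) \<le> 1" for n hs
        using w(2) v by (simp add: norm_mult mult_le_one)
      show "foldr (mult_deriv G) hs f n = f n * (w n (tl hs) * v (n \<otimes>\<^bsub>G\<^esub> inv\<^bsub>G\<^esub> (hd hs)) (tl hs))"
        if "hs \<in> shifts G (Suc s)" for n hs
        using that w(3) by (cases hs) (auto simp: mult_deriv_def v_def)
    qed
  qed
  then obtain w where "dual_weight G s w" "\<forall>n hs. norm (w n hs) \<le> 1"
      "\<forall>n. \<forall>hs\<in>shifts G s. foldr (mult_deriv G) hs f n = f n * w n hs" by auto
  then show ?thesis
    by (intro that[of w]) (auto simp: gowers_average_def average_Times intro!: average_cong)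
qed

section \<open>Polynomial phases\<close>

text \<open>For a polynomial \<open>P\<close> of degree at most \<open>d\<close> the constant \<open>c\<close> is \<open>fact d\<close> times its coefficient of degree \<open>d\<close>.\<close>

fun iterated_difference :: "nat \<Rightarrow> int \<Rightarrow> (int \<Rightarrow> int) \<Rightarrow> bool" where
  "iterated_difference 0 c P \<longleftrightarrow> (\<forall>n. P n = c)"
| "iterated_difference (Suc d) c P \<longleftrightarrow> (\<forall>h. iterated_difference d (c * h) (\<lambda>n. P n - P (n - h)))"

lemma iterated_difference_add:
  "iterated_difference d c P \<Longrightarrow> iterated_difference d c' P' \<Longrightarrow>
   iterated_difference d (c + c') (\<lambda>n. P n + P' n)"
proof (induction d arbitrary: c c' P P')
  case (Suc d)
  show ?case
    unfolding iterated_difference.simps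
  proof
    fix h
    have "iterated_difference d (c * h + c' * h) (\<lambda>n. (P n - P (n - h)) + (P' n - P' (n - h)))"
      using Suc by auto
    then show "iterated_difference d ((c + c') * h) (\<lambda>n. P n + P' n - (P (n - h) + P' (n - h)))"
      by (simp add: algebra_simps)
  qed
qed simp

lemma iterated_difference_mult:
  "iterated_difference d c P \<Longrightarrow> iterated_difference d (a * c) (\<lambda>n. a * P n)"
proof (induction d arbitrary: c P)
  case (Suc d)
  show ?case
    unfolding iterated_difference.simps
  proof
    fix h
    have "iterated_difference d (a * (c * h)) (\<lambda>n. a * (P n - P (n - h)))"
      using Suc by auto
    then show "iterated_difference d (a * c * h) (\<lambda>n. a * P n - a * P (n - h))"
      by (simp add: algebra_simps)
  qed
qed simp

lemma iterated_difference_shift: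
  "iterated_difference d c P \<Longrightarrow> iterated_difference d c (\<lambda>n. P (n - h))"
proof (induction d arbitrary: c P)
  case (Suc d)
  show ?case
    unfolding iterated_difference.simps
  proof
    fix h'
    have "iterated_difference d (c * h') (\<lambda>n. P (n - h) - P (n - h - h'))"
      using Suc.IH[of "c * h'" "\<lambda>n. P n - P (n - h')"] Suc.prems by auto
    then show "iterated_difference d (c * h') (\<lambda>n. P (n - h) - P (n - h' - h))"
      by (simp add: diff_diff_eq add.commute)
  qed
qed simp

text \<open>Discrete Leibniz rule: the difference of \<open>n * P n\<close> is
  \<open>n * (P n - P (n - h)) + h * P (n - h)\<close>. The first term contributes
  \<open>d + 1\<close> and the second 1 to the new factor.\<close>

lemma iterated_difference_times_id:
  "iterated_difference d c P \<Longrightarrow> iterated_difference (Suc d) ((int d + 1) * c) (\<lambda>n. n * P n)"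
proof (induction d arbitrary: c P)
  case 0
  then show ?case by (auto simp: algebra_simps)
next
  case (Suc d)
  show ?case
    unfolding iterated_difference.simps(2)[of "Suc d"]
  proof
    fix h
    have "iterated_difference (Suc d) ((int d + 1) * (c * h)) (\<lambda>n. n * (P n - P (n - h)))"
      by (intro Suc.IH) (use Suc.prems in simp)
    from iterated_difference_add[OF this
        iterated_difference_mult[OF iterated_difference_shift[OF Suc.prems]], of h h]
    show "iterated_difference (Suc d) ((int (Suc d) + 1) * c * h) (\<lambda>n. n * P n - (n - h) * P (n - h))"
      by (simp add: algebra_simps)
  qed
qed

lemma iterated_difference_power: "iterated_difference d (fact d) (\<lambda>n. n ^ d)"
proof (induction d)
  case (Suc d)
  from iterated_difference_times_id[OF this] show ?case by (simp add: algebra_simps)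
qed simp

text \<open>Pascal's rule and summation by parts: an iterated difference of order
  \<open>m + 1\<close> is one of order \<open>m\<close> applied to first differences.\<close>

lemma alternating_sum_Suc:
  fixes g :: "nat \<Rightarrow> int"
  shows "(\<Sum>i\<le>Suc m. (-1) ^ i * int (Suc m choose i) * g i)
       = (\<Sum>i\<le>m. (-1) ^ i * int (m choose i) * (g i - g (Suc i)))"
proof -
  have "(\<Sum>i\<le>Suc m. (-1) ^ i * int (Suc m choose i) * g i)
     = g 0 + (\<Sum>i\<le>m. (-1) ^ Suc i * (int (m choose i) + int (m choose Suc i)) * g (Suc i))"
    by (subst sum.atMost_Suc_shift) (simp add: algebra_simps del: sum.atMost_Suc)
  also have "\<dots> = (g 0 + (\<Sum>i\<le>m. (-1) ^ Suc i * int (m choose Suc i) * g (Suc i)))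
      - (\<Sum>i\<le>m. (-1) ^ i * int (m choose i) * g (Suc i))"
    by (simp add: sum.distrib sum_subtractf sum_negf algebra_simps)
  also have "g 0 + (\<Sum>i\<le>m. (-1) ^ Suc i * int (m choose Suc i) * g (Suc i))
     = (\<Sum>i\<le>Suc m. (-1) ^ i * int (m choose i) * g i)"
    by (subst sum.atMost_Suc_shift) (simp del: sum.atMost_Suc)
  also have "\<dots> = (\<Sum>i\<le>m. (-1) ^ i * int (m choose i) * g i)"
    by simp
  finally show ?thesis
    by (simp add: sum_subtractf algebra_simps)
qed

text \<open>A difference of order \<open>m\<close> annihilates polynomials of degree below
  \<open>m\<close>. With \<open>m = k - 1\<close> and degree \<open>k - 2\<close> this is the linear
  relation along a \<open>k\<close>-AP.\<close>

lemma alternating_sum_iterated_difference: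
  assumes "iterated_difference e c P" "e < m"
  shows "(\<Sum>i\<le>m. (-1) ^ i * int (m choose i) * P (n + int i * h)) = 0"
  using assms
proof (induction e arbitrary: c P m)
  case 0
  then obtain m' where "m = Suc m'" by (cases m) auto
  with 0 show ?case by (simp only: alternating_sum_Suc) simp
next
  case (Suc e)
  then obtain m' where m: "m = Suc m'" by (cases m) auto
  have "\<forall>h. iterated_difference e (c * h) (\<lambda>n. P n - P (n - h))"
    using Suc.prems(1) by simp
  \<comment> \<open>\<open>iterated_difference\<close> looks backwards and the alternating sum
    forwards, hence the negative shift.\<close>
  from spec[OF this, of "- h"]
  have *: "iterated_difference e (c * (- h)) (\<lambda>n. P n - P (n + h))" by simp
  have "P (n + int (Suc i) * h) = P (n + int i * h + h)" for i
    by (simp add: algebra_simps)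
  then show ?case
    using Suc.IH[OF *, of m'] Suc.prems(2) by (simp only: m alternating_sum_Suc Suc_less_eq)
qed

section \<open>Additive characters modulo \<open>p\<close>\<close>

definition phase :: "nat \<Rightarrow> int \<Rightarrow> complex" where
  "phase p x = cis (2 * pi * (of_int x / of_nat p))"

lemma phase_add: "phase p (x + y) = phase p x * phase p y"
  by (simp add: phase_def cis_mult ring_distribs add_divide_distrib)

lemma phase_0 [simp]: "phase p 0 = 1"
  by (simp add: phase_def)

lemma cnj_phase: "cnj (phase p x) = phase p (- x)"
  by (simp add: phase_def cis_cnj)

lemma norm_phase [simp]: "norm (phase p x) = 1"
  by (simp add: phase_def)

lemma phase_power: "phase p (int i * x) = phase p x ^ i"
  by (induction i) (simp_all add: ring_distribs phase_add)

lemma phase_eq_1_iff: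
  assumes "p > 0" shows "phase p x = 1 \<longleftrightarrow> int p dvd x"
proof -
  have *: "2 * pi * y = of_int m * 2 * pi \<longleftrightarrow> y = of_int m" for y :: real and m :: int
  proof -
    have "of_int m * 2 * pi = 2 * pi * of_int m" by simp
    then show ?thesis by (metis mult_left_cancel pi_neq_zero mult_eq_0_iff zero_neq_numeral)
  qed
  have "phase p x = 1 \<longleftrightarrow> cos (2 * pi * (of_int x / real p)) = 1"
    unfolding phase_def by (auto simp: complex_eq_iff cos_one_sin_zero)
  also have "\<dots> \<longleftrightarrow> (\<exists>m::int. of_int x / real p = of_int m)"
    unfolding cos_one_2pi_int * ..
  also have "\<dots> \<longleftrightarrow> (\<exists>m::int. x = m * int p)"
    using assms by (simp add: divide_eq_eq) (metis of_int_eq_iff of_int_mult of_int_of_nat_eq)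
  also have "\<dots> \<longleftrightarrow> int p dvd x" by (auto simp: dvd_def mult.commute)
  finally show ?thesis .
qed

lemma phase_cong:
  assumes "p > 0" "int p dvd x - y" shows "phase p x = phase p y"
proof -
  have "phase p x = phase p (x - y) * phase p y"
    by (simp flip: phase_add)
  then show ?thesis using assms phase_eq_1_iff by simp
qed

lemma sum_phase_eq_0:
  assumes "p > 0" "\<not> int p dvd x" shows "(\<Sum>i<p. phase p (int i * x)) = 0"
proof -
  have "phase p x ^ p = 1"
    by (simp flip: phase_power add: phase_eq_1_iff assms)
  moreover have "phase p x \<noteq> 1" using assms phase_eq_1_iff by blast
  ultimately show ?thesis by (simp add: phase_power geometric_sum)
qed

text \<open>Write \<open>n = b + M t\<close>. For fixed \<open>b\<close> the factor \<open>B\<close>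
  is constant, and the sum over \<open>t\<close> is a complete sum of a nontrivial
  character.\<close>

lemma sum_phase_mult_periodic_eq_0:
  assumes p: "p > 0" "\<not> int p dvd int M * c" and B: "\<And>n. B (n mod int M) = B n"
  shows "(\<Sum>n\<in>{0..<int (M * p)}. B n * phase p (c * n)) = 0"
proof -
  have M: "M > 0" using p by (cases M) auto
  have "bij_betw (\<lambda>(b, t). int b + int M * int t) ({..<M} \<times> {..<p}) {0..<int (M * p)}"
  proof (rule bij_betw_byWitness[where f' = "\<lambda>n. (nat (n mod int M), nat (n div int M))"])
    show "(\<lambda>(b, t). int b + int M * int t) ` ({..<M} \<times> {..<p}) \<subseteq> {0..<int (M * p)}"
    proof clarsimp
      fix b t assume "b < M" "t < p"
      then have "b + M * t < M * Suc t" "M * Suc t \<le> M * p" by (simp_all only: mult_le_mono2 Suc_leI) simp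
      then have "b + M * t < M * p" by linarith
      then show "int b + int M * int t < int M * int p" by (metis of_nat_add of_nat_less_iff of_nat_mult)
    qed
    show "(\<lambda>n. (nat (n mod int M), nat (n div int M))) ` {0..<int (M * p)} \<subseteq> {..<M} \<times> {..<p}"
    proof clarsimp
      fix n assume n: "0 \<le> n" "n < int M * int p"
      have "n div int M < int p"
      proof (rule ccontr)
        assume "\<not> n div int M < int p"
        then have "int M * int p \<le> int M * (n div int M)" by (intro mult_left_mono) auto
        also have "\<dots> \<le> n"
          using mult_div_mod_eq[of "int M" n] pos_mod_sign[of "int M" n] M by linarith
        finally show False using n by simp
      qed
      then show "nat (n mod int M) < M \<and> nat (n div int M) < p"
        using M n by (auto simp: nat_less_iff pos_imp_zdiv_nonneg_iff)
    qed
    show "\<forall>n\<in>{0..<int (M * p)}. (case (nat (n mod int M), nat (n div int M)) of (b, t) \<Rightarrow> int b + int M * int t) = n"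
      using M by (auto simp: pos_imp_zdiv_nonneg_iff)
  qed (use M in auto)
  then have "(\<Sum>n\<in>{0..<int (M * p)}. B n * phase p (c * n))
     = (\<Sum>(b, t)\<in>{..<M} \<times> {..<p}. B (int b + int M * int t) * phase p (c * (int b + int M * int t)))"
    by (subst sum.reindex_bij_betw[symmetric]) (auto simp: case_prod_unfold)
  also have "\<dots> = (\<Sum>b<M. \<Sum>t<p. B (int b) * phase p (c * int b) * phase p (int t * (int M * c)))"
    unfolding sum.cartesian_product[symmetric]
  proof (intro sum.cong refl)
    fix b t
    have "B (int b + int M * int t) = B (int b)"
      using B[of "int b + int M * int t"] B[of "int b"] by simp
    then show "B (int b + int M * int t) * phase p (c * (int b + int M * int t))
        = B (int b) * phase p (c * int b) * phase p (int t * (int M * c))"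
      by (simp add: ring_distribs phase_add mult_ac)
  qed
  also have "\<dots> = 0"
    by (simp add: sum_phase_eq_0[OF p] flip: sum_distrib_left)
  finally show ?thesis .
qed

section \<open>Gowers averages of polynomial phases\<close>

lemma gowers_average_Suc_0:
  assumes "comm_group G"
  shows "gowers_average G (Suc 0) f = average (carrier G) f * cnj (average (carrier G) f)"
  using comm_group.average_mult_cnj[OF assms, of f]
  by (simp add: gowers_average_Suc gowers_average_0)

lemma norm_gowers_average_le_1:
  assumes "finite (carrier G)" "\<And>n. norm (f n) \<le> 1"
  shows "norm (gowers_average G s f) \<le> 1"
proof (cases "carrier G = {}")
  case True
  then show ?thesis by (auto simp: gowers_average_def average_def)
next
  case False
  then have "shifts G s \<noteq> {}" by (rule shifts_nonempty)
  with False assms show ?thesis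
    unfolding gowers_average_def
    by (intro norm_average_le_const) (auto simp: norm_foldr_mult_deriv_le finite_lists_length_eq)
qed

lemma card_multiples:
  assumes "M > 0" shows "card {d\<in>{0..<int (M * p)}. int M dvd d} = p"
proof -
  have "{d\<in>{0..<int (M * p)}. int M dvd d} = (\<lambda>i. int M * int i) ` {..<p}"
  proof (intro equalityI subsetI)
    fix h assume "h \<in> {d\<in>{0..<int (M * p)}. int M dvd d}"
    then obtain i where i: "h = int M * i" "0 \<le> h" "h < int M * int p" by auto
    then have "0 \<le> i" "i < int p" using assms by (auto simp: zero_le_mult_iff)
    then show "h \<in> (\<lambda>i. int M * int i) ` {..<p}" using i by (intro image_eqI[of _ _ "nat i"]) auto
  qed (use assms in auto)
  also have "card \<dots> = p" using assms by (subst card_image) (auto simp: inj_on_def)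
  finally show ?thesis .
qed

lemma mod_shift_integer_mod_group:
  assumes "h \<in> carrier (integer_mod_group N)"
  shows "n \<otimes>\<^bsub>integer_mod_group N\<^esub> inv\<^bsub>integer_mod_group N\<^esub> h = (n - h) mod int N"
  using assms by (simp add: mod_add_right_eq)

text \<open>Differentiating by \<open>h\<close> lowers the degree, turns \<open>c\<close> into
  \<open>c * h\<close> and keeps an \<open>M\<close>-periodic bounded factor. Only the proportion
  \<open>1 / p\<close> of shifts divisible by \<open>p\<close> is lost at each of the
  \<open>d - 1\<close> steps down to degree 1, where the character sum vanishes.\<close>

lemma norm_gowers_average_phase_le:
  assumes p: "prime p" "coprime M p" "d < p" and M: "M > 0"
    and P: "iterated_difference d c P" "d \<ge> 1" "\<not> int p dvd c"
      "\<And>x y. int p dvd x - y \<Longrightarrow> int p dvd P x - P y"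
    and B: "\<And>n. B (n mod int M) = B n" "\<And>n. norm (B n) \<le> 1"
  shows "norm (gowers_average (integer_mod_group (M * p)) d (\<lambda>n. B n * phase p (P n))) \<le> (real d - 1) / real p"
  using P(2,1,3,4) B p(3)
proof (induction d arbitrary: c P B rule: dec_induct)
  case base
  define G where "G = integer_mod_group (M * p)"
  have p0: "p > 0" using p(1) prime_gt_0_nat by blast
  have G: "carrier G = {0..<int (M * p)}"
    using M p0 by (simp add: G_def carrier_integer_mod_group)
  have "\<forall>h n. P n - P (n - h) = c * h" using base(1) by simp
  then have "P n - P 0 = c * n" for n by (metis diff_self)
  then have P: "P n = P 0 + c * n" for n by (metis diff_add_cancel add.commute)
  have eq: "B n * phase p (P n) = phase p (P 0) * (B n * phase p (c * n))" for n
    by (subst P) (simp add: phase_add mult_ac)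
  have "\<not> int p dvd int M * c"
    using p base(2) by (metis coprime_commute coprime_dvd_mult_right_iff coprime_int_iff)
  then have "average (carrier G) (\<lambda>n. B n * phase p (P n)) = 0"
    using sum_phase_mult_periodic_eq_0[of p M c B, OF p0 _ base(4)]
    by (simp add: average_def G eq flip: sum_distrib_left)
  then show ?case
    unfolding One_nat_def using gowers_average_Suc_0[of G] by (simp add: G_def)
next
  case (step d)
  define G where "G = integer_mod_group (M * p)"
  have p0: "p > 0" using p(1) prime_gt_0_nat by blast
  have N0: "M * p > 0" using p0 M by simp
  have G: "carrier G = {0..<int (M * p)}"
    using N0 by (simp add: G_def carrier_integer_mod_group)
  define f where "f = (\<lambda>n. B n * phase p (P n))"
  have f1: "norm (f n) \<le> 1" for n by (simp add: f_def norm_mult step)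
  \<comment> \<open>Shifts divisible by \<open>p\<close> make \<open>c * h\<close> vanish modulo
    \<open>p\<close> and get the trivial bound 1; there are \<open>M\<close> of them among
    \<open>M * p\<close>.\<close>
  let ?b = "\<lambda>h. if int p dvd h then 1 else (real d - 1) / real p"
  have "norm (gowers_average G d (mult_deriv G h f)) \<le> ?b h" if h: "h \<in> carrier G" for h
  proof (cases "int p dvd h")
    case True
    have "norm (mult_deriv G h f n) \<le> 1" for n
      using f1 by (simp add: mult_deriv_def norm_mult mult_le_one)
    with True show ?thesis by (simp add: norm_gowers_average_le_1 G)
  next
    case False
    let ?B = "\<lambda>n. B n * cnj (B (n - h))"
    let ?P = "\<lambda>n. P n - P (n - h)"
    \<comment> \<open>The group reduces \<open>n - h\<close> modulo \<open>M * p\<close>.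
      Periodicity of \<open>B\<close> and the congruence property of \<open>P\<close> allow the
      reduction to be dropped, so that polynomial identities over the integers apply.\<close>
    have shift: "n \<otimes>\<^bsub>G\<^esub> inv\<^bsub>G\<^esub> h = (n - h) mod int (M * p)" for n
      using h unfolding G_def by (rule mod_shift_integer_mod_group)
    have "B ((n - h) mod int (M * p)) = B (n - h)" for n
      using step.prems(4)[of "(n - h) mod int (M * p)"] step.prems(4)[of "n - h"]
      by (simp add: mod_mod_cancel)
    moreover have "phase p (P ((n - h) mod int (M * p))) = phase p (P (n - h))" for n
      using p0 by (intro phase_cong step.prems(3)) (auto simp: mod_eq_dvd_iff[symmetric] mod_mod_cancel)
    ultimately have eq: "mult_deriv G h f = (\<lambda>n. ?B n * phase p (?P n))"
      by (auto simp: mult_deriv_def f_def shift cnj_phase diff_conv_add_uminus phase_add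
          simp del: add_uminus_conv_diff)
    have "norm (gowers_average G d (\<lambda>n. ?B n * phase p (?P n))) \<le> (real d - 1) / real p"
      unfolding G_def
    proof (rule step.IH[of "c * h" ?P ?B])
      show "iterated_difference d (c * h) ?P" using step.prems(1) by simp
      show "\<not> int p dvd c * h"
        using step.prems(2) False p(1) by (simp add: prime_dvd_mult_iff)
      show "int p dvd ?P x - ?P y" if "int p dvd x - y" for x y
      proof -
        have "int p dvd (P x - P y) - (P (x - h) - P (y - h))"
          by (rule dvd_diff; rule step.prems(3)) (use that in auto)
        then show ?thesis by (simp add: algebra_simps)
      qed
      show "?B (n mod int M) = ?B n" for n
        using step.prems(4)[of n] step.prems(4)[of "n mod int M - h"] step.prems(4)[of "n - h"]
        by (simp add: mod_diff_left_eq)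
      show "norm (?B n) \<le> 1" for n
        using step.prems(5) by (simp add: norm_mult mult_le_one)
    qed (use step.prems in auto)
    with False show ?thesis by (simp add: eq)
  qed
  then have "norm (gowers_average G (Suc d) f) \<le> (\<Sum>h\<in>carrier G. ?b h) / card (carrier G)"
    unfolding gowers_average_Suc by (intro norm_average_le) (use N0 in \<open>auto simp: G\<close>)
  also have "(\<Sum>h\<in>carrier G. ?b h) \<le> (\<Sum>h\<in>carrier G. (if int p dvd h then 1 else 0) + (real d - 1) / real p)"
    by (intro sum_mono) (use step.hyps in auto)
  also have "\<dots> = card {h \<in> carrier G. int p dvd h} + card (carrier G) * ((real d - 1) / real p)"
    by (simp add: sum.distrib G sum.If_cases Int_def)
  also have "card {h \<in> carrier G. int p dvd h} = M"
    using card_multiples[OF p0, of M] by (simp add: G mult.commute)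
  finally have "norm (gowers_average G (Suc d) f) \<le> (M + card (carrier G) * ((real d - 1) / real p)) / card (carrier G)"
    by (simp add: divide_right_mono)
  also have "\<dots> = (real (Suc d) - 1) / real p"
    using p0 M step.hyps by (simp add: G field_simps of_nat_diff)
  finally show ?case unfolding f_def G_def .
qed

section \<open>Fourier expansion of intervals\<close>

text \<open>A weak bound chosen for its shape: it is symmetric under \<open>x\<close> to
  \<open>1 - x\<close>, and its reciprocal at \<open>j / p\<close> splits into partial fractions. On
  the left half, Taylor's formula gives sin y \<ge> y / 3 for y \<le> 2.\<close>

lemma sin_pi_ge:
  assumes "0 \<le> x" "x \<le> 1" shows "sin (pi * x) \<ge> x * (1 - x)"
proof -
  have *: "sin (pi * x) \<ge> x * (1 - x)" if x: "0 \<le> x" "x \<le> 1 / 2" for x :: real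
  proof -
    define y where "y = pi * x"
    have "y \<le> 2"
    proof -
      have "y \<le> pi * (1 / 2)" unfolding y_def using x by (intro mult_left_mono) auto
      then show ?thesis using pi_half_less_two by simp
    qed
    have y0: "y \<ge> 0" using x by (simp add: y_def)
    have "(\<Sum>m<3. sin_coeff m * y ^ m) = y"
      by (simp add: numeral_3_eq_3 sin_coeff_def)
    then have "\<bar>sin y - y\<bar> \<le> inverse (fact 3) * \<bar>y\<bar> ^ 3"
      using Maclaurin_sin_bound[of y 3] by simp
    then have "\<bar>sin y - y\<bar> \<le> y ^ 3 / 6" using y0 by (simp add: fact_numeral)
    then have "sin y \<ge> y - y ^ 3 / 6" by linarith
    moreover have "y ^ 3 \<le> 4 * y"
    proof -
      have "y * (y * y) \<le> y * (2 * 2)" using \<open>y \<le> 2\<close> y0 by (intro mult_left_mono mult_mono) auto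
      then show ?thesis by (simp add: power3_eq_cube mult_ac)
    qed
    ultimately have "sin y \<ge> y / 3" by linarith
    moreover have "y / 3 \<ge> x" using pi_gt3 x mult_right_mono[of 3 pi x] by (simp add: y_def)
    moreover have "x \<ge> x * (1 - x)" using x by (simp add: mult_left_le)
    ultimately show ?thesis by (simp add: y_def)
  qed
  show ?thesis
  proof (cases "x \<le> 1 / 2")
    case False
    have "sin (pi * (1 - x)) = sin (pi * x)" by (simp add: right_diff_distrib)
    then show ?thesis using *[of "1 - x"] assms False by (simp add: mult.commute)
  qed (use * assms in simp)
qed

lemma norm_phase_minus_1_ge:
  assumes "0 < j" "j < p"
  shows "norm (phase p (- int j) - 1) \<ge> 2 * (j / p) * (1 - j / p)"
proof -
  have "norm (phase p (- int j) - 1) = 2 * \<bar>sin (pi * (j / p))\<bar>"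
  proof -
    define t where "t = pi * (j / p)"
    have "(norm (phase p (- int j) - 1))\<^sup>2 = (cos (2 * t) - 1)\<^sup>2 + (sin (2 * t))\<^sup>2"
      by (simp add: phase_def t_def cmod_power2 mult.assoc)
    also have "\<dots> = 2 - 2 * cos (2 * t)"
      using sin_cos_squared_add[of "2 * t"] by (simp add: power2_diff)
    also have "\<dots> = (2 * \<bar>sin t\<bar>)\<^sup>2"
      by (simp add: cos_double_sin power_mult_distrib)
    finally show ?thesis unfolding t_def[symmetric] by (rule power2_eq_imp_eq) auto
  qed
  moreover have "sin (pi * (j / p)) \<ge> (j / p) * (1 - j / p)"
    using assms by (intro sin_pi_ge) auto
  ultimately show ?thesis by linarith
qed

text \<open>The Fourier coefficient at frequency \<open>j\<close> of the indicator function of the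
  residues 0, ..., \<open>l - 1\<close> modulo \<open>p\<close>.\<close>

definition interval_coeff :: "nat \<Rightarrow> nat \<Rightarrow> nat \<Rightarrow> complex" where
  "interval_coeff p l j = (\<Sum>y<l. phase p (- int j * int y)) / of_nat p"

lemma norm_interval_coeff_le:
  assumes "0 < j" "j < p"
  shows "norm (interval_coeff p l j) \<le> 1 / real j + 1 / real (p - j)"
proof -
  define z where "z = phase p (- int j)"
  have "(\<Sum>y<l. phase p (- int j * int y)) = (\<Sum>y<l. z ^ y)"
    unfolding z_def phase_power[symmetric] by (simp add: mult.commute)
  have lower: "norm (z - 1) \<ge> 2 * (j / p) * (1 - j / p)"
    unfolding z_def by (rule norm_phase_minus_1_ge[OF assms])
  have pos: "2 * (j / p) * (1 - j / p) > 0" using assms by (simp add: divide_simps)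
  have z1: "z \<noteq> 1" using lower pos by auto
  have "norm (interval_coeff p l j) = norm (z ^ l - 1) / norm (z - 1) / p"
    unfolding interval_coeff_def \<open>(\<Sum>y<l. phase p (- int j * int y)) = _\<close> geometric_sum[OF z1]
    by (simp add: norm_divide norm_mult)
  also have "\<dots> \<le> 2 / (2 * (j / p) * (1 - j / p)) / p"
  proof (intro divide_right_mono frac_le pos lower)
    have "norm (z ^ l - 1) \<le> norm (z ^ l) + norm (1 :: complex)" by (rule norm_triangle_ineq4)
    then show "norm (z ^ l - 1) \<le> 2" by (simp add: z_def norm_power)
  qed auto
  also have "\<dots> = 1 / real j + 1 / real (p - j)"
    using assms by (simp add: of_nat_diff field_simps)
  finally show ?thesis .
qed

lemma sum_inverse_le: "n \<ge> 1 \<Longrightarrow> (\<Sum>j=1..n. 1 / real j) \<le> 1 + ln n"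
proof (induction n rule: dec_induct)
  case (step n)
  have "ln (n / Suc n) \<le> n / Suc n - 1" using step.hyps by (intro ln_le_minus_one) auto
  then have "1 / real (Suc n) \<le> ln (Suc n) - ln n"
    using step.hyps by (simp add: ln_div field_simps)
  then show ?case using step.IH step.hyps by simp
qed simp

text \<open>The coefficients of an interval have only logarithmic total mass. The power of
  \<open>p\<close> saved for each phase absorbs this loss.\<close>

lemma sum_norm_interval_coeff_le:
  assumes "p > 1"
  shows "(\<Sum>j=1..<p. norm (interval_coeff p l j)) \<le> 2 * (1 + ln p)"
proof -
  have "(\<Sum>j=1..<p. norm (interval_coeff p l j)) \<le> (\<Sum>j=1..<p. 1 / real j + 1 / real (p - j))"
    by (intro sum_mono norm_interval_coeff_le) auto
  also have "\<dots> = (\<Sum>j=1..<p. 1 / real j) + (\<Sum>j=1..<p. 1 / real (p - j))"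
    by (simp add: sum.distrib)
  also have "(\<Sum>j=1..<p. 1 / real (p - j)) = (\<Sum>j=1..<p. 1 / real j)"
    by (rule sum.reindex_bij_witness[of _ "\<lambda>j. p - j" "\<lambda>j. p - j"]) (use assms in auto)
  also have "(\<Sum>j=1..<p. 1 / real j) = (\<Sum>j=1..p - 1. 1 / real j)"
    using assms by (intro sum.cong) auto
  also have "(\<Sum>j=1..p - 1. 1 / real j) \<le> 1 + ln (p - 1)" using assms by (intro sum_inverse_le) auto
  also have "ln (p - 1) \<le> ln (real p)" using assms by simp
  finally show ?thesis by simp
qed

text \<open>Orthogonality of characters detects each residue \<open>y < l\<close>. Frequency 0 is
  separated because it carries the density.\<close>

lemma interval_Fourier_expansion:
  assumes p: "p > 0" and l: "l \<le> p"
  shows "(if x mod int p < int l then 1 else 0)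
     = of_nat l / of_nat p + (\<Sum>j=1..<p. interval_coeff p l j * phase p (int j * x))"
proof -
  have eq: "int p dvd x - int y \<longleftrightarrow> y = nat (x mod int p)" if "y < p" for y
    using that p by (auto simp: mod_eq_dvd_iff[symmetric] nat_eq_iff)
  have "(\<Sum>j<p. phase p (int j * (x - int y))) = (if y = nat (x mod int p) then of_nat p else 0)"
    if "y < p" for y
  proof (cases "int p dvd x - int y")
    case True
    then have "phase p (int j * (x - int y)) = 1" for j using p by (simp add: phase_eq_1_iff)
    then have "(\<Sum>j<p. phase p (int j * (x - int y))) = of_nat p" by simp
    moreover have "y = nat (x mod int p)" using True eq[OF that] by simp
    ultimately show ?thesis by (simp only: if_True simp_thms)
  qed (use sum_phase_eq_0[OF p] eq[OF that] in simp)
  then have "(\<Sum>y<l. \<Sum>j<p. phase p (int j * (x - int y)))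
      = (\<Sum>y<l. if y = nat (x mod int p) then of_nat p else 0)"
    using l by (intro sum.cong) auto
  also have "\<dots> = (if nat (x mod int p) < l then of_nat p else 0)" by simp
  also have "\<dots> = of_nat p * (if x mod int p < int l then 1 else 0)"
    using p by (auto simp: nat_less_iff)
  finally have "(if x mod int p < int l then 1 else 0)
      = (\<Sum>y<l. \<Sum>j<p. phase p (int j * (x - int y))) / (of_nat p :: complex)"
    using p by (auto simp: field_simps split: if_splits)
  also have "\<dots> = (\<Sum>j<p. \<Sum>y<l. phase p (- int j * int y) * phase p (int j * x)) / of_nat p"
    by (subst sum.swap) (simp add: phase_add[symmetric] algebra_simps)
  also have "\<dots> = (\<Sum>j<p. interval_coeff p l j * phase p (int j * x))"
    by (simp add: interval_coeff_def sum_distrib_right sum_divide_distrib)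
  also have "{..<p} = insert 0 {1..<p}" using p by auto
  also have "(\<Sum>j\<in>insert 0 {1..<p}. interval_coeff p l j * phase p (int j * x))
     = of_nat l / of_nat p + (\<Sum>j=1..<p. interval_coeff p l j * phase p (int j * x))"
    by (simp add: interval_coeff_def)
  finally show ?thesis .
qed

section \<open>Generic positions and colorings\<close>

text \<open>
  Greedy choice: every pattern \<open>(I, c)\<close> in which the new label has nonzero total coefficient excludes
  at most one value for it, and there are at most \<open>(2 * card \<Gamma>) ^ card J\<close> patterns.
\<close>

lemma exists_generic_labels:
  fixes a :: "'i \<Rightarrow> int" and \<Gamma> :: "'c set"
  assumes "finite J" "finite \<Gamma>"
  shows "\<exists>T. (\<forall>x\<in>\<Gamma>. 0 \<le> T x \<and> T x \<le> (2 * int (card \<Gamma>)) ^ card J) \<and>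
    (\<forall>I\<subseteq>J. \<forall>c\<in>I \<rightarrow> \<Gamma>. (\<Sum>i\<in>I. a i * T (c i)) = 0 \<longrightarrow> (\<forall>x. (\<Sum>i\<in>{i\<in>I. c i = x}. a i) = 0))"
  using assms(2)
proof (induction \<Gamma> rule: finite_induct)
  case empty
  show ?case
  proof (intro exI conjI ballI allI impI)
    fix I c x
    assume "I \<subseteq> J" "c \<in> I \<rightarrow> ({} :: 'c set)"
    then have "I = {}" by auto
    then show "(\<Sum>i\<in>{i\<in>I. c i = x}. a i) = 0" by simp
  qed auto
next
  case (insert y \<Gamma>)
  from insert.IH obtain T where T0: "\<forall>x\<in>\<Gamma>. 0 \<le> T x \<and> T x \<le> (2 * int (card \<Gamma>)) ^ card J"
    and gen0: "\<forall>I\<subseteq>J. \<forall>c\<in>I \<rightarrow> \<Gamma>. (\<Sum>i\<in>I. a i * T (c i)) = 0 \<longrightarrow>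
      (\<forall>x. (\<Sum>i\<in>{i\<in>I. c i = x}. a i) = 0)"
    by (elim exE conjE)
  have T: "0 \<le> T x" "T x \<le> (2 * int (card \<Gamma>)) ^ card J" if "x \<in> \<Gamma>" for x
    using T0 that by auto
  have gen: "(\<Sum>i\<in>{i\<in>I. c i = x}. a i) = 0"
    if "I \<subseteq> J" "c \<in> I \<rightarrow> \<Gamma>" "(\<Sum>i\<in>I. a i * T (c i)) = 0" for I c x
    using gen0[rule_format, OF that] .
  define R where "R = card (insert y \<Gamma>)"
  have R: "R \<ge> 1" using insert.hyps by (simp add: R_def)
  have finJ: "finite I" if "I \<subseteq> J" for I using that assms(1) finite_subset by blast
  \<comment> \<open>The one value of the new label that could complete the relation of a pattern. If
    the divisor is zero or the division inexact, the value is meaningless, but excluding it does no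
    harm.\<close>
  define bad where "bad = (\<lambda>(I, c). - (\<Sum>i\<in>{i\<in>I. c i \<noteq> y}. a i * T (c i)) div (\<Sum>i\<in>{i\<in>I. c i = y}. a i))"
  define Pat where "Pat = (SIGMA I:Pow J. PiE I (\<lambda>_. insert y \<Gamma>))"
  have cardPi: "card (PiE I (\<lambda>_. insert y \<Gamma>)) = R ^ card I" if "I \<subseteq> J" for I
    unfolding R_def by (rule card_funcsetE[OF finJ[OF that]])
  have "card Pat = (\<Sum>I\<in>Pow J. R ^ card I)"
    unfolding Pat_def using assms(1) insert.hyps(1)
    by (subst card_SigmaI) (auto simp: finJ cardPi intro!: sum.cong finite_PiE)
  also have "\<dots> \<le> (\<Sum>I\<in>Pow J. R ^ card J)"
    by (intro sum_mono power_increasing R card_mono assms(1)) auto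
  also have "\<dots> = (2 * R) ^ card J"
    using assms(1) by (simp add: card_Pow power_mult_distrib)
  finally have "card Pat \<le> (2 * R) ^ card J" .
  moreover have "finite Pat"
    unfolding Pat_def using assms(1) insert.hyps(1) by (auto simp: finJ intro!: finite_PiE)
  \<comment> \<open>There is one candidate more than there are patterns, so some candidate
    survives.\<close>
  moreover have "card {0..int m} = Suc m" for m by simp
  ultimately have "card (bad ` Pat) < card {0..int ((2 * R) ^ card J)}"
    using card_image_le[of Pat bad] by (metis le_imp_less_Suc le_trans)
  then have "\<not> {0..int ((2 * R) ^ card J)} \<subseteq> bad ` Pat"
    using card_mono[of "bad ` Pat"] \<open>finite Pat\<close> by (metis finite_imageI leD)
  then obtain t where t: "0 \<le> t" "t \<le> int ((2 * R) ^ card J)" "t \<notin> bad ` Pat"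
    by (meson atLeastAtMost_iff subsetI)
  show ?case
  proof (intro exI[of _ "T(y := t)"] conjI ballI allI impI)
    fix x assume x: "x \<in> insert y \<Gamma>"
    then show "0 \<le> (T(y := t)) x" using T t by auto
    have "(2 * int (card \<Gamma>)) ^ card J \<le> (2 * int R) ^ card J"
      using insert.hyps by (intro power_mono) (auto simp: R_def)
    then show "(T(y := t)) x \<le> (2 * int (card (insert y \<Gamma>))) ^ card J"
      using order_trans[OF T(2)[of x]] t(2) x unfolding R_def[symmetric] by (cases "x = y") simp_all
  next
    fix I c x
    assume I: "I \<subseteq> J" and c: "c \<in> I \<rightarrow> insert y \<Gamma>" and eq: "(\<Sum>i\<in>I. a i * (T(y := t)) (c i)) = 0"
    define w where "w = (\<Sum>i\<in>{i\<in>I. c i = y}. a i)"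
    define I' where "I' = {i\<in>I. c i \<noteq> y}"
    have "I = I' \<union> {i\<in>I. c i = y}" by (auto simp: I'_def)
    then have "(\<Sum>i\<in>I. a i * (T(y := t)) (c i))
        = (\<Sum>i\<in>I'. a i * (T(y := t)) (c i)) + (\<Sum>i\<in>{i\<in>I. c i = y}. a i * (T(y := t)) (c i))"
      using finJ[OF I] by (subst (1) \<open>I = _\<close>, subst sum.union_disjoint) (auto simp: I'_def)
    also have "(\<Sum>i\<in>I'. a i * (T(y := t)) (c i)) = (\<Sum>i\<in>I'. a i * T (c i))"
      by (intro sum.cong) (auto simp: I'_def)
    also have "(\<Sum>i\<in>{i\<in>I. c i = y}. a i * (T(y := t)) (c i)) = w * t"
      by (auto simp: w_def sum_distrib_right intro!: sum.cong)
    finally have split: "(\<Sum>i\<in>I'. a i * T (c i)) + w * t = 0" using eq by simp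
    have "w = 0"
    proof (rule ccontr)
      assume "w \<noteq> 0"
      \<comment> \<open>Patterns in \<open>Pat\<close> are extensional functions, so
        \<open>c\<close> is restricted to \<open>I\<close>.\<close>
      define c' where "c' = restrict c I"
      have c': "{i\<in>I. c' i \<noteq> y} = I'" "{i\<in>I. c' i = y} = {i\<in>I. c i = y}"
        by (auto simp: c'_def I'_def)
      have "(\<Sum>i\<in>I'. a i * T (c' i)) = (\<Sum>i\<in>I'. a i * T (c i))"
        by (intro sum.cong) (auto simp: c'_def I'_def)
      moreover have "- (\<Sum>i\<in>I'. a i * T (c i)) = w * t" using split by linarith
      ultimately have "bad (I, c') = w * t div w"
        unfolding bad_def by (simp only: case_prod_conv c' w_def[symmetric])
      then have "bad (I, c') = t" using \<open>w \<noteq> 0\<close> by simp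
      moreover have "(I, c') \<in> Pat"
        using I c by (auto simp: Pat_def c'_def)
      ultimately show False using t(3) by blast
    qed
    show "(\<Sum>i\<in>{i\<in>I. c i = x}. a i) = 0"
    proof (cases "x = y")
      case True
      with \<open>w = 0\<close> show ?thesis by (simp add: w_def)
    next
      case False
      then have "{i\<in>I. c i = x} = {i\<in>I'. c i = x}" by (auto simp: I'_def)
      moreover have "c \<in> I' \<rightarrow> \<Gamma>" "I' \<subseteq> J" using c I by (auto simp: I'_def)
      ultimately show ?thesis
        using gen[of I' c x] split \<open>w = 0\<close> by simp
    qed
  qed
qed

text \<open>
  Behrend's coloring. Equal digit blocks prevent carries in the relation \<open>u x + v z = (u + v) y\<close>, which
  therefore holds digit by digit, and strict convexity of the square applies.
\<close>

fun digit_squares :: "nat \<Rightarrow> nat \<Rightarrow> int \<Rightarrow> int" where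
  "digit_squares q 0 x = 0"
| "digit_squares q (Suc D) x = (x mod int q)\<^sup>2 + digit_squares q D (x div int q)"

fun digit_blocks :: "nat \<Rightarrow> nat \<Rightarrow> nat \<Rightarrow> int \<Rightarrow> nat list" where
  "digit_blocks w q 0 x = []"
| "digit_blocks w q (Suc D) x = nat (x mod int q) div w # digit_blocks w q D (x div int q)"

lemma digit_squares_bounds:
  assumes "q > 0"
  shows "0 \<le> digit_squares q D x \<and> digit_squares q D x \<le> int D * (int q)\<^sup>2"
proof (induction D arbitrary: x)
  case (Suc D)
  have "(x mod int q)\<^sup>2 \<le> (int q)\<^sup>2"
    using assms by (intro power_mono) (auto simp: less_imp_le)
  then show ?case using Suc[of "x div int q"] by (simp add: algebra_simps)
qed simp

lemma digit_blocks_mem: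
  assumes "q > 0"
  shows "digit_blocks w q D x \<in> {l. set l \<subseteq> {..q div w} \<and> length l = D}"
proof (induction D arbitrary: x)
  case (Suc D)
  have "nat (x mod int q) \<le> q" using assms by (simp add: nat_le_iff less_imp_le)
  then have "nat (x mod int q) div w \<le> q div w" by (rule div_le_mono)
  then show ?case using Suc[of "x div int q"] by simp
qed simp

lemma abs_diff_less_if_div_eq:
  fixes x y :: nat
  assumes "w > 0" "x div w = y div w"
  shows "\<bar>int x - int y\<bar> < int w"
proof -
  have "x = w * (y div w) + x mod w" "y = w * (y div w) + y mod w"
    using assms(2) mult_div_mod_eq by metis+
  moreover have "x mod w < w" "y mod w < w" using assms(1) by simp_all
  ultimately show ?thesis by linarith
qed

text \<open>The inequality is proved along with the equality case because the induction needs it: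
  every digit contributes a nonnegative excess, so total equality forces each excess to
  vanish.\<close>

lemma digit_squares_strictly_convex:
  fixes x y z :: int
  assumes u: "u > 0" and v: "v > 0" and w: "w > 0" "(u + v) * int w \<le> int q"
    and bl: "digit_blocks w q D x = digit_blocks w q D y" "digit_blocks w q D z = digit_blocks w q D y"
    and dvd: "int (q ^ D) dvd u * x + v * z - (u + v) * y"
  shows "u * digit_squares q D x + v * digit_squares q D z \<ge> (u + v) * digit_squares q D y \<and>
    (u * digit_squares q D x + v * digit_squares q D z = (u + v) * digit_squares q D y \<longrightarrow>
      int (q ^ D) dvd x - y \<and> int (q ^ D) dvd z - y)"
  using bl dvd
proof (induction D arbitrary: x y z)
  case (Suc D)
  have q: "q > 0" using u v w by (metis add_pos_pos less_le_trans mult_pos_pos of_nat_0_less_iff)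
  define x0 y0 z0 x1 y1 z1 where
    defs: "x0 = x mod int q" "y0 = y mod int q" "z0 = z mod int q"
      "x1 = x div int q" "y1 = y div int q" "z1 = z div int q"
  have xyz: "x = int q * x1 + x0" "y = int q * y1 + y0" "z = int q * z1 + z0"
    unfolding defs by simp_all
  have nn: "0 \<le> x0" "0 \<le> y0" "0 \<le> z0" using q by (simp_all add: defs)
  \<comment> \<open>The defect of the relation in the lowest digit. It is divisible by
    \<open>q\<close> and smaller than \<open>q\<close> in absolute value, so it vanishes and nothing
    is carried.\<close>
  define e where "e = u * (x0 - y0) + v * (z0 - y0)"
  have e: "u * x + v * z - (u + v) * y = e + int q * (u * x1 + v * z1 - (u + v) * y1)"
    unfolding xyz e_def by (simp add: algebra_simps)
  have xy: "\<bar>x0 - y0\<bar> < int w" and zy: "\<bar>z0 - y0\<bar> < int w"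
    using Suc.prems(1,2) abs_diff_less_if_div_eq[OF w(1), of "nat x0" "nat y0"]
      abs_diff_less_if_div_eq[OF w(1), of "nat z0" "nat y0"] nn by (simp_all add: defs)
  have "\<bar>e\<bar> \<le> u * \<bar>x0 - y0\<bar> + v * \<bar>z0 - y0\<bar>"
    unfolding e_def using u v by (metis abs_mult abs_of_pos abs_triangle_ineq)
  also have "\<dots> < u * int w + v * int w"
    using xy zy u v by (intro add_strict_mono mult_strict_left_mono)
  also have "\<dots> \<le> int q" using w(2) by (simp add: algebra_simps)
  finally have "\<bar>e\<bar> < int q" .
  moreover have "int q dvd e"
  proof -
    have "int q dvd u * x + v * z - (u + v) * y" using Suc.prems(3) by (auto intro: dvd_trans[OF dvd_triv_left])
    then show ?thesis unfolding e by (simp add: dvd_add_left_iff)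
  qed
  ultimately have e0: "e = 0" by (metis abs_0_eq abs_ge_zero abs_of_nonneg dvd_imp_le_int leD of_nat_0_le_iff)
  have "int (q ^ D) dvd u * x1 + v * z1 - (u + v) * y1"
    using Suc.prems(3) q unfolding e e0 by simp
  moreover have "digit_blocks w q D x1 = digit_blocks w q D y1" "digit_blocks w q D z1 = digit_blocks w q D y1"
    using Suc.prems by (simp_all add: defs)
  ultimately have IH: "u * digit_squares q D x1 + v * digit_squares q D z1 \<ge> (u + v) * digit_squares q D y1"
    "u * digit_squares q D x1 + v * digit_squares q D z1 = (u + v) * digit_squares q D y1 \<Longrightarrow>
      int (q ^ D) dvd x1 - y1 \<and> int (q ^ D) dvd z1 - y1"
    using Suc.IH by blast+
  have "u * x0\<^sup>2 + v * z0\<^sup>2 - (u + v) * y0\<^sup>2 = u * (x0 - y0)\<^sup>2 + v * (z0 - y0)\<^sup>2 + 2 * y0 * e"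
    unfolding e_def by (simp add: power2_eq_square algebra_simps)
  then have sq: "u * x0\<^sup>2 + v * z0\<^sup>2 = (u + v) * y0\<^sup>2 + (u * (x0 - y0)\<^sup>2 + v * (z0 - y0)\<^sup>2)"
    using e0 by simp
  have pos: "u * (x0 - y0)\<^sup>2 \<ge> 0" "v * (z0 - y0)\<^sup>2 \<ge> 0" using u v by simp_all
  have ds: "digit_squares q (Suc D) x = x0\<^sup>2 + digit_squares q D x1"
    "digit_squares q (Suc D) y = y0\<^sup>2 + digit_squares q D y1"
    "digit_squares q (Suc D) z = z0\<^sup>2 + digit_squares q D z1"
    by (simp_all add: defs)
  have split: "u * digit_squares q (Suc D) x + v * digit_squares q (Suc D) z - (u + v) * digit_squares q (Suc D) y
    = (u * digit_squares q D x1 + v * digit_squares q D z1 - (u + v) * digit_squares q D y1)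
      + (u * (x0 - y0)\<^sup>2 + v * (z0 - y0)\<^sup>2)"
    using sq unfolding ds by (simp add: algebra_simps)
  show ?case
  proof (intro conjI impI)
    show "(u + v) * digit_squares q (Suc D) y \<le> u * digit_squares q (Suc D) x + v * digit_squares q (Suc D) z"
      using split IH(1) pos by linarith
    assume "u * digit_squares q (Suc D) x + v * digit_squares q (Suc D) z = (u + v) * digit_squares q (Suc D) y"
    with split IH(1) pos have
      eq: "u * digit_squares q D x1 + v * digit_squares q D z1 = (u + v) * digit_squares q D y1"
      and "u * (x0 - y0)\<^sup>2 = 0" "v * (z0 - y0)\<^sup>2 = 0" by linarith+
    then have "x0 = y0" "z0 = y0" using u v by simp_all
    then have "x - y = int q * (x1 - y1)" "z - y = int q * (z1 - y1)"
      unfolding xyz by (simp_all add: algebra_simps)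
    then show "int (q ^ Suc D) dvd x - y" "int (q ^ Suc D) dvd z - y"
      using IH(2)[OF eq] by simp_all
  qed
qed simp

text \<open>A row of Pascal's triangle is strictly increasing up to its middle, strictly decreasing
  after it, and symmetric.\<close>

lemma binomial_eq_binomial_cases:
  assumes "n choose i = n choose j" "i \<le> n" "j \<le> n"
  shows "j = i \<or> j = n - i"
proof -
  have *: "j = i \<or> j = n - i" if "n choose i = n choose j" "i \<le> n" "j \<le> n" "i \<le> j" for i j
  proof (rule ccontr)
    assume ne: "\<not> (j = i \<or> j = n - i)"
    consider "2 * j \<le> n" | "2 * i \<ge> n" | "2 * i < n" "2 * j > n" by linarith
    then show False
    proof cases
      case 1
      then show ?thesis using binomial_strict_mono[of i j n] that ne by auto
    next
      case 2
      then show ?thesis using binomial_strict_antimono[of i j n] that ne by auto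
    next
      case 3
      have sym: "n choose j = n choose (n - j)" by (rule binomial_symmetric[OF that(3)])
      have "2 * (n - j) \<le> n" "2 * i \<le> n" using 3 by linarith+
      then show ?thesis
        using binomial_strict_mono[of i "n - j" n] binomial_strict_mono[of "n - j" i n] sym that 3 ne
        by (cases i "n - j" rule: linorder_cases) auto
    qed
  qed
  show ?thesis using *[of i j] *[of j i] assms by (cases "i \<le> j") auto
qed

section \<open>Zero-sum color classes\<close>

definition alternating_binomial :: "nat \<Rightarrow> nat \<Rightarrow> int" where
  "alternating_binomial k i = (- 1) ^ i * int (k - 1 choose i)"

definition zero_sum_colored :: "nat \<Rightarrow> (int \<Rightarrow> 'c) \<Rightarrow> (nat \<Rightarrow> int) \<Rightarrow> bool" where
  "zero_sum_colored k \<psi> x \<longleftrightarrow>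
     (\<forall>\<gamma>. (\<Sum>i\<in>{i\<in>{..<k}. \<psi> (x i) = \<gamma>}. alternating_binomial k i) = 0)"

text \<open>No single coefficient is zero, so the class of \<open>i\<close> has a second element,
  and by assumption no third. The two coefficients cancel, hence the binomials agree in absolute
  value and the indices are mirror images.\<close>

lemma zero_sum_colored_imp_symmetric:
  assumes z: "zero_sum_colored k \<psi> x"
    and three: "\<And>i j l. i < j \<Longrightarrow> j < l \<Longrightarrow> l < k \<Longrightarrow> \<psi> (x i) = \<psi> (x j) \<Longrightarrow> \<psi> (x l) = \<psi> (x j) \<Longrightarrow> False"
    and i: "i < k"
  shows "\<psi> (x (k - 1 - i)) = \<psi> (x i)"
proof -
  define C where "C = {j\<in>{..<k}. \<psi> (x j) = \<psi> (x i)}"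
  have sum: "(\<Sum>j\<in>C. alternating_binomial k j) = 0"
    using z by (simp add: zero_sum_colored_def C_def)
  have nz: "alternating_binomial k i \<noteq> 0"
    using i by (simp add: alternating_binomial_def)
  have "C \<noteq> {i}" using sum nz by auto
  moreover have "i \<in> C" using i by (simp add: C_def)
  ultimately obtain j where j: "j \<in> C" "j \<noteq> i" by blast
  have "l = i \<or> l = j" if l: "l \<in> C" for l
  proof (rule ccontr)
    assume ne: "\<not> (l = i \<or> l = j)"
    have col: "\<psi> (x a) = \<psi> (x b)" "a < k" if "a \<in> C" "b \<in> C" for a b
      using that by (simp_all add: C_def)
    have "\<exists>a b c. a \<in> C \<and> b \<in> C \<and> c \<in> C \<and> a < b \<and> b < c"
      using l j \<open>i \<in> C\<close> ne by (metis nat_neq_iff)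
    then show False using three col by blast
  qed
  then have "C = {i, j}" using j \<open>i \<in> C\<close> by blast
  then have eq: "alternating_binomial k i = - alternating_binomial k j" using sum j by auto
  have "\<bar>alternating_binomial k i\<bar> = \<bar>alternating_binomial k j\<bar>" unfolding eq by simp
  then have "k - 1 choose i = k - 1 choose j"
    by (simp add: alternating_binomial_def abs_mult)
  then have "j = k - 1 - i"
    using binomial_eq_binomial_cases[of "k - 1" i j] j i by (auto simp: C_def)
  then show ?thesis using j by (simp add: C_def)
qed

text \<open>Excludes wrapping around modulo \<open>M\<close>. The middle pair gives a small
  representative of \<open>d\<close>, the outer pair shows that the last term is exact, and the
  intermediate terms lie between the two ends.\<close>

lemma symmetric_residues_imp_progression:
  fixes n d :: int and M W k :: nat
  defines "x \<equiv> \<lambda>i. (n + int i * d) mod int M"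
  assumes k: "k > 0" "even k" and W: "k * W \<le> M" "M > 0"
    and close: "\<And>i. i < k \<Longrightarrow> \<bar>x (k - 1 - i) - x i\<bar> < int W"
  obtains \<delta> where "int M dvd d - \<delta>" "\<And>i. i < k \<Longrightarrow> x i = x 0 + int i * \<delta>"
proof -
  define h where "h = k div 2"
  have h: "k = 2 * h" "h > 0" using k by (auto simp: h_def)
  define \<delta> where "\<delta> = x h - x (h - 1)"
  have dvdx: "int M dvd x i - (n + int i * d)" for i
    unfolding x_def by (simp add: mod_eq_dvd_iff[symmetric])
  have "int M dvd (x h - (n + int h * d)) - (x (h - 1) - (n + int (h - 1) * d))"
    by (intro dvd_diff dvdx)
  then have "int M dvd \<delta> - d" using h(2) by (simp add: \<delta>_def of_nat_diff algebra_simps)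
  then have d\<delta>: "int M dvd d - \<delta>" by (metis dvd_diff_commute)
  have id: "int M dvd x i - (x 0 + int i * \<delta>)" for i
  proof -
    have "int M dvd (x i - (n + int i * d)) - (x 0 - (n + int 0 * d)) + int i * (d - \<delta>)"
      by (intro dvd_add dvd_diff dvdx dvd_mult d\<delta>)
    then show ?thesis by (simp add: algebra_simps)
  qed
  have "k - 1 - (h - 1) = h" using h by simp
  then have \<delta>W: "\<bar>\<delta>\<bar> < int W" using close[of "h - 1"] h by (simp add: \<delta>_def)
  have \<Delta>W: "\<bar>x (k - 1) - x 0\<bar> < int W" using close[of 0] k by simp
  have "\<bar>x (k - 1) - (x 0 + int (k - 1) * \<delta>)\<bar> \<le> \<bar>x (k - 1) - x 0\<bar> + int (k - 1) * \<bar>\<delta>\<bar>"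
    by (metis abs_mult abs_of_nat abs_triangle_ineq4 diff_diff_add)
  also have "\<dots> < int W + int (k - 1) * int W"
    using \<delta>W \<Delta>W by (intro add_less_le_mono mult_left_mono) auto
  also have "\<dots> = int (k * W)" using k(1) by (simp add: of_nat_diff algebra_simps)
  also have "\<dots> \<le> int M" using W(1) by linarith
  finally have last: "x (k - 1) = x 0 + int (k - 1) * \<delta>"
    using id[of "k - 1"] by (metis abs_ge_zero dvd_imp_le_int eq_iff_diff_eq_0 leD abs_of_nat)
  have range: "0 \<le> x i" "x i < int M" for i using W(2) by (simp_all add: x_def)
  have "x i = x 0 + int i * \<delta>" if i: "i < k" for i
  proof (cases "k = 1")
    case False
    have k1: "int (k - 1) > 0" using k h by auto
    \<comment> \<open>The candidate term is a convex combination of the first and last residues, so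
      it already lies in the range of residues.\<close>
    have eq: "int (k - 1) * (x 0 + int i * \<delta>) = int (k - 1 - i) * x 0 + int i * x (k - 1)"
      unfolding last using i by (simp add: of_nat_diff algebra_simps)
    have "int (k - 1) * (x 0 + int i * \<delta>) \<ge> 0" unfolding eq using range by simp
    then have lo: "0 \<le> x 0 + int i * \<delta>" using k1 by (simp add: zero_le_mult_iff)
    have "int (k - 1) * (x 0 + int i * \<delta>) \<le> int (k - 1 - i) * (int M - 1) + int i * (int M - 1)"
      unfolding eq using range by (intro add_mono mult_left_mono) (auto simp: zle_diff1_eq)
    also have "\<dots> = int (k - 1) * (int M - 1)" using i by (simp add: of_nat_diff algebra_simps)
    finally have hi: "x 0 + int i * \<delta> < int M" using k1 by (simp add: mult_le_cancel_left_pos)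
    have "x i mod int M = (x 0 + int i * \<delta>) mod int M" using id[of i] by (simp add: mod_eq_dvd_iff)
    then show ?thesis using lo hi range[of i] by simp
  qed (use i in simp)
  then show ?thesis using that d\<delta> by blast
qed

text \<open>The first component is the given coloring, shifted because residues start at 0 and the
  colored interval at 1. The next two form the Behrend coloring, which leaves at most two indices
  per class. The last one puts mirror images within distance \<open>q ^ D div k\<close>, which
  prevents wrapping.\<close>

definition symmetric_free_color :: "nat \<Rightarrow> nat \<Rightarrow> nat \<Rightarrow> (int \<Rightarrow> nat) \<Rightarrow> int \<Rightarrow> nat \<times> nat list \<times> int \<times> nat" where
  "symmetric_free_color k q D c x =
     (c (x + 1), digit_blocks (q div k) q D x, digit_squares q D x, nat x div (q ^ D div k))"

text \<open>If \<open>M\<close> does not divide \<open>d\<close>, three indices never share a color,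
  so the coloring is symmetric along the progression. The residues then form a genuine progression
  in the colored interval, which the choice of \<open>c\<close> forbids.\<close>

lemma zero_sum_colored_imp_dvd:
  fixes n d :: int and k q D :: nat and c :: "int \<Rightarrow> nat"
  assumes k: "k > 0" "even k" and q: "q \<ge> k" "D \<ge> 1" "\<And>m. 0 < m \<Longrightarrow> m < k \<Longrightarrow> coprime m q"
    and c: "\<not> contains_sym_colored_AP k (q ^ D) c"
    and z: "zero_sum_colored k (symmetric_free_color k q D c) (\<lambda>i. (n + int i * d) mod int (q ^ D))"
  shows "int (q ^ D) dvd d"
proof (rule ccontr)
  assume nd: "\<not> int (q ^ D) dvd d"
  define M where "M = q ^ D"
  define x where "x = (\<lambda>i. (n + int i * d) mod int M)"
  define \<psi> where "\<psi> = symmetric_free_color k q D c"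
  have q0: "q > 0" using k q by simp
  have M: "M > 0" "M \<ge> k"
    using q0 q by (simp_all add: M_def) (metis One_nat_def Suc_le_eq le_trans self_le_power)
  have w: "q div k > 0" "k * (q div k) \<le> q" "M div k > 0" "k * (M div k) \<le> M"
    using k q M by (simp_all add: div_greater_zero_iff)
  have dvdx: "int M dvd x i - (n + int i * d)" for i
    unfolding x_def by (simp add: mod_eq_dvd_iff[symmetric])
  have range: "0 \<le> x i" "x i < int M" for i using M(1) by (simp_all add: x_def)
  have three: False if ijl: "i < j" "j < l" "l < k" "\<psi> (x i) = \<psi> (x j)" "\<psi> (x l) = \<psi> (x j)" for i j l
  proof -
    \<comment> \<open>The outer terms of the triple, weighted by the opposite gaps, balance the
      middle one modulo \<open>M\<close>.\<close>
    define u v where "u = int l - int j" and "v = int j - int i"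
    have uv: "u > 0" "v > 0" "u + v \<le> int k" using ijl by (auto simp: u_def v_def)
    have "(u + v) * int (q div k) \<le> int k * int (q div k)" using uv by (intro mult_right_mono) auto
    also have "\<dots> \<le> int q" using w(2) by (metis of_nat_le_iff of_nat_mult)
    finally have wq: "(u + v) * int (q div k) \<le> int q" .
    have "int M dvd u * (x i - (n + int i * d)) + v * (x l - (n + int l * d)) - (u + v) * (x j - (n + int j * d))"
      by (intro dvd_add dvd_diff dvd_mult dvdx)
    also have "\<dots> = u * x i + v * x l - (u + v) * x j"
      by (simp add: u_def v_def algebra_simps)
    finally have "int (q ^ D) dvd x i - x j"
      using digit_squares_strictly_convex[OF uv(1,2) w(1) wq, of D "x i" "x j" "x l"] ijl(4,5)
      by (auto simp: \<psi>_def symmetric_free_color_def M_def algebra_simps)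
    then have "int M dvd (x i - x j) - (x i - (n + int i * d)) + (x j - (n + int j * d))"
      by (intro dvd_add[OF dvd_diff[OF _ dvdx] dvdx]) (simp add: M_def)
    also have "\<dots> = - (int (j - i) * d)" using ijl by (simp add: of_nat_diff algebra_simps)
    finally have "int M dvd int (j - i) * d" by simp
    moreover have "coprime (int M) (int (j - i))"
      using q(3)[of "j - i"] ijl unfolding M_def coprime_int_iff by (auto simp: coprime_commute)
    ultimately show False using nd by (simp add: M_def coprime_dvd_mult_right_iff)
  qed
  have sym: "\<psi> (x (k - 1 - i)) = \<psi> (x i)" if "i < k" for i
  proof (rule zero_sum_colored_imp_symmetric[of k \<psi> x, OF _ _ that])
    show "zero_sum_colored k \<psi> x" using z by (simp add: \<psi>_def x_def M_def)
  qed (use three in blast)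
  have close: "\<bar>x (k - 1 - i) - x i\<bar> < int (M div k)" if "i < k" for i
    using abs_diff_less_if_div_eq[OF w(3), of "nat (x (k - 1 - i))" "nat (x i)"] sym[OF that] range
    by (simp add: \<psi>_def symmetric_free_color_def M_def)
  obtain \<delta> where \<delta>: "int M dvd d - \<delta>" "\<And>i. i < k \<Longrightarrow> x i = x 0 + int i * \<delta>"
    using symmetric_residues_imp_progression[OF k w(4) M(1) close[unfolded x_def]] unfolding x_def by blast
  have "sym_colored_AP k c (x 0 + 1) \<delta>"
    unfolding sym_colored_AP_def
  proof (intro conjI ballI)
    show "\<delta> \<noteq> 0" using \<delta>(1) nd by (auto simp: M_def)
    fix i assume i: "i \<in> {1..k div 2}"
    \<comment> \<open>\<open>sym_colored_AP\<close> counts terms from 1, the residues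
      \<open>x\<close> from 0.\<close>
    then have i': "i - 1 < k" "k - i < k" "k - 1 - (i - 1) = k - i" "i \<le> k" by auto
    have "x 0 + 1 + (int i - 1) * \<delta> = x (i - 1) + 1" "x 0 + 1 + (int k - int i) * \<delta> = x (k - i) + 1"
      using \<delta>(2)[OF i'(1)] \<delta>(2)[OF i'(2)] i i'(4) by (simp_all add: of_nat_diff)
    moreover have "c (x (i - 1) + 1) = c (x (k - i) + 1)"
      using sym[OF i'(1)] unfolding i'(3) by (simp add: \<psi>_def symmetric_free_color_def)
    ultimately show "c (x 0 + 1 + (int i - 1) * \<delta>) = c (x 0 + 1 + (int k - int i) * \<delta>)" by (simp only:)
  qed
  moreover have "x 0 + 1 + int i * \<delta> \<in> {1..int M}" if "i < k" for i
    using \<delta>(2)[OF that] range[of i] by simp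
  ultimately have "contains_sym_colored_AP k M c"
    unfolding contains_sym_colored_AP_def by blast
  with c show False by (simp add: M_def)
qed

text \<open>Dividing by the rounded length \<open>m div k\<close> yields quotients at most
  \<open>2 * k\<close>, since \<open>m\<close> is less than twice
  \<open>k * (m div k)\<close>.\<close>

lemma symmetric_free_color_mem:
  assumes k: "k > 0" and q: "q \<ge> k" "D \<ge> 1" and c: "c \<in> {1..int (q ^ D)} \<rightarrow> {1..r}" and x: "x \<in> {0..<int (q ^ D)}"
  shows "symmetric_free_color k q D c x \<in>
    {1..r} \<times> {l. set l \<subseteq> {..2 * k} \<and> length l = D} \<times> {0..int D * (int q)\<^sup>2} \<times> {..2 * k}"
proof -
  have *: "m div (m div k) \<le> 2 * k" if "k \<le> m" for m
  proof -
    have "m = k * (m div k) + m mod k" by simp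
    also have "\<dots> \<le> k * (m div k) + k * (m div k)"
    proof -
      have "m mod k \<le> k * 1" using k by simp
      also have "\<dots> \<le> k * (m div k)" using that k by (intro mult_left_mono) (auto simp: Suc_leI div_greater_zero_iff)
      finally show ?thesis by (rule add_left_mono)
    qed
    finally have "m \<le> 2 * k * (m div k)" by simp
    then have "m div (m div k) \<le> (2 * k * (m div k)) div (m div k)" by (rule div_le_mono)
    also have "\<dots> \<le> 2 * k" by (metis div_mult_self_is_m div_by_0 eq_imp_le gr0I zero_le)
    finally show ?thesis .
  qed
  have q0: "q > 0" using k q by simp
  have "q ^ 1 \<le> q ^ D" using q0 q(2) by (intro power_increasing) auto
  then have kM: "k \<le> q ^ D" using q by simp
  have "nat x div (q ^ D div k) \<le> q ^ D div (q ^ D div k)" using x by (intro div_le_mono) (auto simp: nat_le_iff)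
  then have "nat x div (q ^ D div k) \<le> 2 * k" using *[OF kM] by linarith
  moreover have "c (x + 1) \<in> {1..r}" using c x by (auto simp: Pi_iff)
  moreover have "set (digit_blocks (q div k) q D x) \<subseteq> {..2 * k}"
    using digit_blocks_mem[OF q0, of "q div k" D x] *[OF q(1)] by auto
  ultimately show ?thesis
    using digit_blocks_mem[OF q0, of "q div k" D x] digit_squares_bounds[OF q0, of D x]
    by (simp add: symmetric_free_color_def)
qed

section \<open>Level sets of polynomial phases\<close>

text \<open>\<open>S\<close> gives the left end of the interval and depends on \<open>n\<close>
  modulo \<open>M\<close> only, which makes its contribution to every phase
  \<open>M\<close>-periodic.\<close>

definition level_set :: "nat \<Rightarrow> nat \<Rightarrow> nat \<Rightarrow> nat \<Rightarrow> (int \<Rightarrow> int) \<Rightarrow> int set" where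
  "level_set M p s l S = {n\<in>{0..<int (M * p)}. (n ^ s - S (n mod int M)) mod int p < int l}"

text \<open>Expand one factor of the Gowers average by \<open>interval_Fourier_expansion\<close>.
  The constant term leaves the rounding error of the density, and each phase is controlled by its
  own Gowers average through \<open>gowers_Cauchy_Schwarz\<close>.\<close>

lemma norm_gowers_average_level_set_le:
  fixes \<alpha> :: real
  assumes p: "prime p" "coprime M p" "s < p" and M: "M > 0" and s: "s \<ge> 1"
    and l: "l \<le> p" and \<alpha>: "0 \<le> \<alpha>" "\<alpha> \<le> 1"
  shows "norm (gowers_average (integer_mod_group (M * p)) s
           (\<lambda>n. indicator (level_set M p s l S) n - complex_of_real \<alpha>))
     \<le> \<bar>l / p - \<alpha>\<bar> + 2 * (1 + ln p) * root (2 ^ s) ((real s - 1) / p)"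
proof -
  define G where "G = integer_mod_group (M * p)"
  define f where "f = (\<lambda>n. indicator (level_set M p s l S) n - complex_of_real \<alpha>)"
  have p1: "p > 1" using p(1) prime_gt_1_nat by blast
  have G: "carrier G = {0..<int (M * p)}"
    using M p1 by (simp add: G_def carrier_integer_mod_group)
  interpret G: comm_group G unfolding G_def by (rule abelian_integer_mod_group)
  have fin: "finite (carrier G)" "carrier G \<noteq> {}" using M p1 by (auto simp: G)
  have "f n = complex_of_real (indicator (level_set M p s l S) n - \<alpha>)" for n
    by (simp add: f_def indicator_def)
  then have "norm (f n) = \<bar>indicator (level_set M p s l S) n - \<alpha>\<bar>" for n
    by (simp only: norm_of_real)
  then have "norm (f n) \<le> 1" for n
    using \<alpha> by (auto simp: indicator_def)
  then obtain w where w: "dual_weight G s w" "\<And>n hs. norm (w n hs) \<le> 1"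
    and avg: "gowers_average G s f = average (carrier G) (\<lambda>n. average (shifts G s) (\<lambda>hs. f n * w n hs))"
    using gowers_average_dual_weight[of f G s] by blast
  define \<kappa> where "\<kappa> = interval_coeff p l"
  define B where "B = (\<lambda>j n. phase p (- (int j * S (n mod int M))))"
  define P where "P = (\<lambda>j n :: int. int j * n ^ s)"
  define \<phi> where "\<phi> = (\<lambda>j n. B j n * phase p (P j n))"
  define \<theta> where "\<theta> = l / p - \<alpha>"
  define W where "W = (\<lambda>g. average (carrier G) (\<lambda>n. average (shifts G s) (\<lambda>hs. g n * w n hs)))"
  have fexp: "f n = complex_of_real \<theta> + (\<Sum>j=1..<p. \<kappa> j * \<phi> j n)" if "n \<in> carrier G" for n
  proof -
    have "indicator (level_set M p s l S) n
        = (if (n ^ s - S (n mod int M)) mod int p < int l then 1 else (0::complex))"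
      using that by (auto simp: level_set_def G indicator_def)
    also have "\<dots> = of_nat l / of_nat p + (\<Sum>j=1..<p. \<kappa> j * phase p (int j * (n ^ s - S (n mod int M))))"
      unfolding \<kappa>_def using p1 l by (intro interval_Fourier_expansion) auto
    also have "(\<Sum>j=1..<p. \<kappa> j * phase p (int j * (n ^ s - S (n mod int M)))) = (\<Sum>j=1..<p. \<kappa> j * \<phi> j n)"
      unfolding \<phi>_def B_def P_def phase_add[symmetric] by (simp add: algebra_simps)
    finally show ?thesis unfolding f_def \<theta>_def by simp
  qed
  have \<phi>: "norm (W (\<phi> j)) \<le> root (2 ^ s) ((real s - 1) / p)" if j: "j \<in> {1..<p}" for j
  proof -
    have "norm (W (\<phi> j)) ^ 2 ^ s \<le> Re (gowers_average G s (\<phi> j))"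
      unfolding W_def by (rule G.gowers_Cauchy_Schwarz[OF fin(1) w(1) s])
    also have "\<dots> \<le> norm (gowers_average G s (\<phi> j))" by (rule complex_Re_le_cmod)
    also have "\<dots> \<le> (real s - 1) / p"
      unfolding \<phi>_def G_def
    proof (rule norm_gowers_average_phase_le[OF p M _ s])
      show "iterated_difference s (int j * fact s) (P j)"
        unfolding P_def by (intro iterated_difference_mult iterated_difference_power)
      \<comment> \<open>The bound \<open>s < p\<close> keeps the leading constant of the phase
        invertible modulo \<open>p\<close>.\<close>
      have "\<not> p dvd j * fact s"
        using p(1,3) j by (auto simp: prime_dvd_mult_iff prime_dvd_fact_iff dest: dvd_imp_le)
      then show "\<not> int p dvd int j * fact s"
        by (metis int_dvd_int_iff of_nat_fact of_nat_mult)
      show "int p dvd P j x - P j y" if "int p dvd x - y" for x y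
      proof -
        have "x ^ s mod int p = y ^ s mod int p"
          using that by (metis mod_eq_dvd_iff power_mod)
        then show ?thesis unfolding P_def
          by (simp add: mod_eq_dvd_iff flip: right_diff_distrib)
      qed
    qed (simp_all add: B_def)
    finally have "norm (W (\<phi> j)) ^ 2 ^ s \<le> (real s - 1) / p" .
    then have "root (2 ^ s) (norm (W (\<phi> j)) ^ 2 ^ s) \<le> root (2 ^ s) ((real s - 1) / p)"
      by simp
    then show ?thesis by (simp add: real_root_power_cancel)
  qed
  have "shifts G s \<noteq> {}" using fin(2) by (rule shifts_nonempty)
  then have W1: "norm (W (\<lambda>n. 1)) \<le> 1"
    unfolding W_def using w(2) fin by (intro norm_average_le_const finite_lists_length_eq) auto
  have "gowers_average G s f = average (carrier G) (\<lambda>n. average (shifts G s) (\<lambda>hs.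
      complex_of_real \<theta> * (1 * w n hs) + (\<Sum>j=1..<p. \<kappa> j * (\<phi> j n * w n hs))))"
    unfolding avg
    by (intro average_cong) (simp only: fexp ring_distribs sum_distrib_right mult.assoc mult_1)
  also have "\<dots> = complex_of_real \<theta> * W (\<lambda>n. 1) + (\<Sum>j=1..<p. \<kappa> j * W (\<phi> j))"
    unfolding W_def by (simp only: average_add average_sum average_mult_left)
  finally have "norm (gowers_average G s f) \<le> norm (complex_of_real \<theta> * W (\<lambda>n. 1)) + norm (\<Sum>j=1..<p. \<kappa> j * W (\<phi> j))"
    by (simp only: norm_triangle_ineq)
  also have "norm (complex_of_real \<theta> * W (\<lambda>n. 1)) \<le> \<bar>\<theta>\<bar>"
    using W1 by (simp add: norm_mult mult_left_le)
  also have "norm (\<Sum>j=1..<p. \<kappa> j * W (\<phi> j)) \<le> (\<Sum>j=1..<p. norm (\<kappa> j) * root (2 ^ s) ((real s - 1) / p))"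
    by (intro sum_norm_le) (simp add: norm_mult \<phi> mult_left_mono)
  also have "\<dots> \<le> 2 * (1 + ln p) * root (2 ^ s) ((real s - 1) / p)"
    unfolding sum_distrib_right[symmetric] \<kappa>_def using s
    by (intro mult_right_mono sum_norm_interval_coeff_le p1) auto
  finally show ?thesis unfolding G_def f_def \<theta>_def by simp
qed

text \<open>Only differences divisible by \<open>M\<close> contribute, and they are the proportion
  \<open>1 / M\<close> of all differences.\<close>

lemma Re_AP_average_indicator_le:
  assumes M: "M > 0" "p > 0"
    and *: "\<And>n d. (\<And>i. i < k \<Longrightarrow> (n + int i * d) mod int (M * p) \<in> A) \<Longrightarrow> int M dvd d"
  shows "Re (AP_average (integer_mod_group (M * p)) k (indicator A)) \<le> 1 / M"
proof -
  define G where "G = integer_mod_group (M * p)"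
  have G: "carrier G = {0..<int (M * p)}"
    using M by (simp add: G_def carrier_integer_mod_group)
  let ?F = "\<lambda>(n, d). \<Prod>i<k. indicator A (n \<otimes>\<^bsub>G\<^esub> d [^]\<^bsub>G\<^esub> i) :: complex"
  let ?H = "\<lambda>(n :: int, d). if int M dvd d then 1 else (0 :: real)"
  have "norm (?F nd) \<le> ?H nd" for nd
  proof (cases nd)
    case (Pair n d)
    have norm: "norm (indicator A x :: complex) \<le> 1" for x by (simp add: indicator_def)
    have elem: "n \<otimes>\<^bsub>G\<^esub> d [^]\<^bsub>G\<^esub> i = (n + int i * d) mod int (M * p)" for i :: nat
      by (simp add: G_def mod_add_right_eq)
    show ?thesis
    proof (cases "int M dvd d")
      case True
      then show ?thesis using norm by (auto simp: Pair prod_norm[symmetric] intro!: prod_le_1)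
    next
      case False
      then obtain i where "i < k" "n \<otimes>\<^bsub>G\<^esub> d [^]\<^bsub>G\<^esub> i \<notin> A" using *[of n d] elem by metis
      then show ?thesis using False by (auto simp: Pair intro!: bexI[of _ i])
    qed
  qed
  then have "norm (AP_average G k (indicator A)) \<le> (\<Sum>nd\<in>carrier G \<times> carrier G. ?H nd) / card (carrier G \<times> carrier G)"
    unfolding AP_average_def using M by (intro norm_average_le) (auto simp: G)
  also have "(\<Sum>nd\<in>carrier G \<times> carrier G. ?H nd) = (\<Sum>n\<in>carrier G. \<Sum>d\<in>carrier G. if int M dvd d then 1 else 0)"
    by (rule sum.cartesian_product[symmetric])
  also have "\<dots> = real (M * p) * real p"
    using card_multiples[OF M(1), of p] by (simp add: G sum.If_cases Int_def)
  also have "\<dots> / card (carrier G \<times> carrier G) = 1 / M"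
    using M by (simp add: G card_cartesian_product)
  finally show ?thesis
    unfolding G_def using complex_Re_le_cmod order_trans by blast
qed

section \<open>Separating the positions of the intervals\<close>

lemma sum_abs_alternating_binomial:
  "k > 0 \<Longrightarrow> (\<Sum>i<k. \<bar>alternating_binomial k i\<bar>) = 2 ^ (k - 1)"
proof -
  assume "k > 0"
  then have "{..<k} = {..k - 1}" by auto
  then have "(\<Sum>i<k. \<bar>alternating_binomial k i\<bar>) = int (\<Sum>i\<le>k - 1. k - 1 choose i)"
    by (simp add: alternating_binomial_def abs_mult)
  then show ?thesis by (simp add: choose_row_sum)
qed

lemma abs_sum_alternating_binomial_le:
  assumes "k > 0" "\<And>i. i < k \<Longrightarrow> 0 \<le> y i" "\<And>i. i < k \<Longrightarrow> y i \<le> (b :: int)"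
  shows "\<bar>\<Sum>i<k. alternating_binomial k i * y i\<bar> \<le> 2 ^ (k - 1) * b"
proof -
  have "\<bar>\<Sum>i<k. alternating_binomial k i * y i\<bar> \<le> (\<Sum>i<k. \<bar>alternating_binomial k i\<bar> * b)"
    using assms(2,3) by (intro order_trans[OF sum_abs] sum_mono) (auto simp: abs_mult intro!: mult_left_mono)
  then show ?thesis
    by (simp add: sum_abs_alternating_binomial[OF assms(1)] flip: sum_distrib_right)
qed

text \<open>Modulo \<open>p\<close> each power is \<open>J * t i + y i\<close>, a position plus an
  offset below \<open>l\<close>. The alternating sum annihilates the powers, so
  \<open>J * Z + Y\<close> is divisible by \<open>p\<close>; it is too small to be nonzero, and |Y|
  < J then forces \<open>Z = 0\<close>.\<close>

lemma level_set_progression_sum_eq_0: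
  fixes n d :: int and T :: "'c \<Rightarrow> int"
  assumes k: "k \<ge> 2" and M: "M > 0" and p: "p > 0"
    and T: "\<And>x. x \<in> {0..<int M} \<Longrightarrow> 0 \<le> T (\<psi> x) \<and> T (\<psi> x) \<le> b"
    and J: "int J * (2 ^ (k - 1) * b + 1) \<le> int p" "2 ^ (k - 1) * l \<le> J"
    and A: "\<And>i. i < k \<Longrightarrow> (n + int i * d) mod int (M * p) \<in> level_set M p (k - 2) l (\<lambda>x. int J * T (\<psi> x))"
  shows "(\<Sum>i<k. alternating_binomial k i * T (\<psi> ((n + int i * d) mod int M))) = 0"
proof (rule ccontr)
  let ?a = "alternating_binomial k"
  define x where "x = (\<lambda>i. n + int i * d)"
  define t where "t = (\<lambda>i. T (\<psi> (x i mod int M)))"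
  define y where "y = (\<lambda>i. (x i ^ (k - 2) - int J * t i) mod int p)"
  define Z where "Z = (\<Sum>i<k. ?a i * t i)"
  define Y where "Y = (\<Sum>i<k. ?a i * y i)"
  assume "(\<Sum>i<k. ?a i * T (\<psi> ((n + int i * d) mod int M))) \<noteq> 0"
  then have Z0: "Z \<noteq> 0" by (simp add: Z_def t_def x_def)
  have y: "0 \<le> y i" "y i \<le> int l - 1" if "i < k" for i
  proof -
    have "((x i mod int (M * p)) ^ (k - 2) - int J * t i) mod int p < int l"
      using A[OF that] by (simp add: level_set_def t_def x_def mod_mod_cancel)
    also have "((x i mod int (M * p)) ^ (k - 2) - int J * t i) mod int p = y i"
    proof -
      have "(x i mod int (M * p)) mod int p = x i mod int p" by (simp add: mod_mod_cancel)
      then have "(x i mod int (M * p)) ^ (k - 2) mod int p = x i ^ (k - 2) mod int p"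
        by (metis power_mod)
      then show ?thesis unfolding y_def by (rule mod_diff_cong) (rule refl)
    qed
    finally show "y i \<le> int l - 1" by simp
    show "0 \<le> y i" using p by (simp add: y_def)
  qed
  \<comment> \<open>Offsets are at most \<open>l - 1\<close>, which makes |Y| < J strict although
    \<open>2 ^ (k - 1) * l\<close> may equal \<open>J\<close>.\<close>
  have "\<bar>Y\<bar> \<le> 2 ^ (k - 1) * (int l - 1)"
    unfolding Y_def using k y by (intro abs_sum_alternating_binomial_le) auto
  also have "\<dots> < int (2 ^ (k - 1) * l)" by (simp add: right_diff_distrib)
  also have "\<dots> \<le> int J" using J(2) by linarith
  finally have YJ: "\<bar>Y\<bar> < int J" .
  have Zb: "\<bar>Z\<bar> \<le> 2 ^ (k - 1) * b"
    unfolding Z_def t_def using k M T by (intro abs_sum_alternating_binomial_le) auto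
  have "\<bar>int J * Z + Y\<bar> \<le> int J * \<bar>Z\<bar> + \<bar>Y\<bar>"
    by (metis abs_mult abs_of_nat abs_triangle_ineq)
  also have "\<dots> < int J * (2 ^ (k - 1) * b) + int J"
    using Zb YJ by (intro add_le_less_mono mult_left_mono) auto
  also have "\<dots> \<le> int p" using J(1) by (simp add: algebra_simps)
  finally have small: "\<bar>int J * Z + Y\<bar> < int p" .
  have "{..<k} = {..k - 1}" using k by auto
  then have zero: "(\<Sum>i<k. ?a i * x i ^ (k - 2)) = 0"
    unfolding x_def alternating_binomial_def
    using alternating_sum_iterated_difference[OF iterated_difference_power[of "k - 2"], of "k - 1" n d] k
    by simp
  have "int p dvd (\<Sum>i<k. ?a i * (x i ^ (k - 2) - int J * t i - y i))"
    unfolding y_def by (intro dvd_sum dvd_mult) (simp add: minus_mod_eq_mult_div)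
  also have "(\<Sum>i<k. ?a i * (x i ^ (k - 2) - int J * t i - y i)) = - (int J * Z + Y)"
    using zero by (simp add: Z_def Y_def right_diff_distrib sum_subtractf sum_distrib_left mult_ac)
  finally have "int p dvd int J * Z + Y" by (simp only: dvd_minus_iff)
  then have "int J * Z + Y = 0"
    using small by (metis abs_ge_zero abs_of_nat dvd_imp_le_int leD abs_0_eq)
  then have "\<bar>Y\<bar> = int J * \<bar>Z\<bar>" by (metis abs_minus_cancel abs_mult abs_of_nat add.inverse_unique)
  moreover have "int J * 1 \<le> int J * \<bar>Z\<bar>" using Z0 by (intro mult_left_mono) auto
  ultimately show False using YJ by simp
qed

section \<open>Upper bounds for rho\<close>

text \<open>For every tolerance, a large prime \<open>p\<close> gives a set that is uniform enough
  to be tested by the lower bound and has \<open>k\<close>-AP density at most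
  \<open>1 / M\<close>.\<close>

lemma AP_lower_bound_le:
  fixes \<psi> :: "int \<Rightarrow> 'c" and \<alpha> \<rho> :: real
  assumes k: "k \<ge> 4" and M: "M > 0" and \<Gamma>: "finite \<Gamma>" "\<psi> ` {0..<int M} \<subseteq> \<Gamma>"
    and \<psi>: "\<And>n d. zero_sum_colored k \<psi> (\<lambda>i. (n + int i * d) mod int M) \<Longrightarrow> int M dvd d"
    and \<alpha>: "0 < \<alpha>" "\<alpha> < 1" "\<alpha> * (8 * real (card \<Gamma>)) ^ k \<le> 1"
    and \<rho>: "AP_lower_bound k \<alpha> \<rho>"
  shows "\<rho> \<le> 1 / M"
proof (rule field_le_epsilon)
  fix \<epsilon> :: real assume "\<epsilon> > 0"
  then obtain \<eta> N\<^sub>0 where \<eta>: "\<eta> > 0" and N\<^sub>0: "\<And>N A. N \<ge> N\<^sub>0 \<Longrightarrow> N \<ge> 1 \<Longrightarrow> A \<subseteq> carrier (integer_mod_group N) \<Longrightarrow>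
      gowers_norm (integer_mod_group N) (k - 2) (\<lambda>n. indicator A n - complex_of_real \<alpha>) \<le> \<eta> \<Longrightarrow>
      Re (AP_average (integer_mod_group N) k (indicator A)) \<ge> \<rho> - \<epsilon>"
    using \<rho> unfolding AP_lower_bound_def by metis
  define s where "s = k - 2"
  have s: "s \<ge> 2" using k by (simp add: s_def)
  define R where "R = card \<Gamma>"
  define b where "b = (2 * int R) ^ k"
  obtain T where T: "\<And>x. x \<in> \<Gamma> \<Longrightarrow> 0 \<le> T x \<and> T x \<le> b"
    and gen: "\<And>c :: nat \<Rightarrow> 'c. c \<in> {..<k} \<rightarrow> \<Gamma> \<Longrightarrow> (\<Sum>i<k. alternating_binomial k i * T (c i)) = 0 \<Longrightarrow>
      \<forall>x. (\<Sum>i\<in>{i\<in>{..<k}. c i = x}. alternating_binomial k i) = 0"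
  proof -
    from exists_generic_labels[OF finite_lessThan[of k] \<Gamma>(1), where a = "alternating_binomial k"]
    obtain T where "\<forall>x\<in>\<Gamma>. 0 \<le> T x \<and> T x \<le> (2 * int (card \<Gamma>)) ^ card {..<k}"
      "\<forall>I\<subseteq>{..<k}. \<forall>c\<in>I \<rightarrow> \<Gamma>. (\<Sum>i\<in>I. alternating_binomial k i * T (c i)) = 0 \<longrightarrow>
         (\<forall>x. (\<Sum>i\<in>{i\<in>I. c i = x}. alternating_binomial k i) = 0)"
      by (elim exE conjE)
    then show thesis by (intro that[of T]) (auto simp: b_def R_def)
  qed
  have "R > 0" using M \<Gamma> by (auto simp: R_def card_gt_0_iff)
  \<comment> \<open>The spacing will be about \<open>p / P\<close>. \<open>P\<close> exceeds every
    value that \<open>Z\<close> can take, and the assumption on \<alpha> is exactly what lets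
    intervals of density \<alpha> fit into this spacing.\<close>
  define P where "P = 2 ^ (k - 1) * (2 * R) ^ k + 2"
  have "2 ^ (k - 1) * P \<le> (8 * R) ^ k"
  proof -
    define x r where "x = (2 :: nat) ^ (k - 1)" and "r = R ^ k"
    have two: "2 ^ k = 2 * x" using k by (cases k) (auto simp: x_def)
    have "(8 :: nat) ^ k = 2 ^ k * 2 ^ k * 2 ^ k" by (simp flip: power_mult_distrib)
    then have "(8 * R) ^ k = 8 * (x * x * x * r)"
      by (simp add: power_mult_distrib two r_def)
    moreover have "x * P = 2 * (x * x * x * r) + 2 * x"
      unfolding P_def x_def[symmetric] by (simp add: power_mult_distrib two r_def algebra_simps)
    moreover have "x * 1 \<le> x * (x * x * r)"
      using \<open>R > 0\<close> by (intro mult_left_mono) (auto simp: x_def r_def Suc_le_eq)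
    ultimately show ?thesis unfolding x_def[symmetric] by (simp add: mult.assoc)
  qed
  then have "\<alpha> * real (2 ^ (k - 1) * P) \<le> \<alpha> * real ((8 * R) ^ k)"
    using \<alpha>(1) by (intro mult_left_mono) (simp_all only: of_nat_le_iff less_imp_le)
  also have "\<dots> \<le> 1" using \<alpha>(3) by (simp add: R_def)
  finally have \<alpha>P: "\<alpha> * real (2 ^ (k - 1) * P) \<le> 1" .
  \<comment> \<open>The first term is the cost of rounding \<open>\<alpha> * p\<close> down to
    \<open>l\<close>. In the second the negative power of \<open>p\<close> from the root beats the
    logarithm.\<close>
  define err where "err = (\<lambda>p::nat. 1 / p + 2 * (1 + ln p) * root (2 ^ s) ((real s - 1) / p))"
  have "err \<longlonglongrightarrow> 0"
  proof -
    define c where "c = 1 / real (2 ^ s)"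
    define a where "a = real s - 1"
    have c: "c > 0" by (simp add: c_def)
    have a: "a > 0" using s by (simp add: a_def)
    have "(\<lambda>p::nat. (1 + ln (real p)) * real p powr - c) \<longlonglongrightarrow> 0"
      using c by real_asymp
    from tendsto_add[OF lim_1_over_n tendsto_mult_right_zero[OF this, of "2 * a powr c"]]
    have "(\<lambda>p::nat. 1 / real p + 2 * a powr c * ((1 + ln (real p)) * real p powr - c)) \<longlonglongrightarrow> 0"
      by simp
    moreover have "eventually (\<lambda>p::nat. 1 / real p + 2 * a powr c * ((1 + ln (real p)) * real p powr - c) = err p) sequentially"
      using eventually_gt_at_top[of 0]
    proof eventually_elim
      case (elim p)
      then have "root (2 ^ s) (a / real p) = (a / real p) powr c"
        unfolding c_def using a by (intro root_powr_inverse) auto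
      also have "\<dots> = a powr c * real p powr - c"
        using a elim by (simp add: powr_divide powr_minus_divide)
      finally show ?case by (simp add: err_def a_def[symmetric])
    qed
    ultimately show ?thesis by (rule Lim_transform_eventually)
  qed
  then have "eventually (\<lambda>p. err p < \<eta> ^ 2 ^ s) sequentially"
    using \<eta> by (intro order_tendstoD(2)) auto
  then obtain p\<^sub>0 where p\<^sub>0: "\<And>p. p \<ge> p\<^sub>0 \<Longrightarrow> err p < \<eta> ^ 2 ^ s"
    by (auto simp: eventually_sequentially)
  \<comment> \<open>One bound for four purposes: a small error, a large modulus, coprimality to
    \<open>M\<close>, and \<open>s < p\<close>.\<close>
  obtain p where p: "prime p" "p > p\<^sub>0 + N\<^sub>0 + M + s"
    using bigger_prime by blast
  have p0: "p > 0" using p(2) by simp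
  have cop: "coprime M p"
    using p M by (metis coprime_commute dvd_imp_le leD less_imp_le_nat not_less prime_imp_coprime trans_less_add2 add.commute less_add_same_cancel2 add_lessD1)
  define l where "l = nat \<lfloor>\<alpha> * p\<rfloor>"
  have l: "real l \<le> \<alpha> * p" "\<alpha> * p < real l + 1"
    using \<alpha>(1) unfolding l_def by (auto simp: of_nat_nat)
  have "\<alpha> * p \<le> p" using \<alpha> p0 by (simp add: mult_left_le_one_le)
  then have lp: "l \<le> p" using l(1) by linarith
  have "real l / p - \<alpha> = (real l - \<alpha> * p) / p" using p0 by (simp add: diff_divide_distrib)
  then have "\<bar>l / p - \<alpha>\<bar> = \<bar>real l - \<alpha> * p\<bar> / p" by simp
  also have "\<dots> \<le> 1 / p" using l by (intro divide_right_mono) auto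
  finally have "\<bar>l / p - \<alpha>\<bar> \<le> 1 / p" .
  define J where "J = p div P"
  have "P > 0" by (simp add: P_def)
  have JP: "J * P \<le> p" by (simp add: J_def)
  have "2 ^ (k - 1) * l \<le> J"
  proof -
    have "real (2 ^ (k - 1) * P) * real l \<le> real (2 ^ (k - 1) * P) * (\<alpha> * p)"
      using l(1) by (intro mult_left_mono) auto
    also have "\<dots> = (\<alpha> * real (2 ^ (k - 1) * P)) * p" by simp
    also have "\<dots> \<le> 1 * real p" using \<alpha>P by (intro mult_right_mono) auto
    finally have "real (2 ^ (k - 1) * P * l) \<le> real p" by simp
    then have "2 ^ (k - 1) * l * P \<le> p" by (simp only: of_nat_le_iff mult_ac)
    then show ?thesis using \<open>P > 0\<close> by (simp add: J_def less_eq_div_iff_mult_less_eq)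
  qed
  have Jb: "int J * (2 ^ (k - 1) * b + 1) \<le> int p"
  proof -
    have "int J * (2 ^ (k - 1) * b + 1) \<le> int J * int P"
      by (intro mult_left_mono) (auto simp: P_def b_def)
    also have "\<dots> \<le> int p" using JP by (metis of_nat_le_iff of_nat_mult)
    finally show ?thesis .
  qed
  define A where "A = level_set M p s l (\<lambda>x. int J * T (\<psi> x))"
  define N where "N = M * p"
  have "p \<le> N" using M by (simp add: N_def)
  then have N: "N \<ge> N\<^sub>0" "N \<ge> 1" using p by linarith+
  have "A \<subseteq> carrier (integer_mod_group N)"
    using N by (auto simp: A_def level_set_def carrier_integer_mod_group N_def)
  moreover have "gowers_norm (integer_mod_group N) s (\<lambda>n. indicator A n - complex_of_real \<alpha>) \<le> \<eta>"
  proof -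
    let ?g = "gowers_average (integer_mod_group N) s (\<lambda>n. indicator A n - complex_of_real \<alpha>)"
    have "Re ?g \<le> norm ?g" by (rule complex_Re_le_cmod)
    also have "\<dots> \<le> \<bar>l / p - \<alpha>\<bar> + 2 * (1 + ln p) * root (2 ^ s) ((real s - 1) / p)"
      unfolding A_def N_def using p \<alpha> M s lp
      by (intro norm_gowers_average_level_set_le cop) auto
    also have "\<dots> \<le> err p" using \<open>\<bar>l / p - \<alpha>\<bar> \<le> 1 / p\<close> by (simp add: err_def)
    also have "\<dots> \<le> \<eta> ^ 2 ^ s" using p\<^sub>0[of p] p(2) by simp
    finally have "root (2 ^ s) (Re ?g) \<le> root (2 ^ s) (\<eta> ^ 2 ^ s)" by simp
    also have "\<dots> = \<eta>" using \<eta> by (intro real_root_power_cancel) auto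
    finally show ?thesis by (simp add: gowers_norm_def)
  qed
  ultimately have "\<rho> - \<epsilon> \<le> Re (AP_average (integer_mod_group N) k (indicator A))"
    using N\<^sub>0[OF N] by (simp add: s_def)
  also have "\<dots> \<le> 1 / M"
    unfolding N_def
  proof (rule Re_AP_average_indicator_le[OF M p0])
    fix n d :: int
    assume *: "(n + int i * d) mod int (M * p) \<in> A" if "i < k" for i
    have mem: "\<psi> ((n + int i * d) mod int M) \<in> \<Gamma>" for i using \<Gamma>(2) M by auto
    have "(\<Sum>i<k. alternating_binomial k i * T (\<psi> ((n + int i * d) mod int M))) = 0"
    proof (rule level_set_progression_sum_eq_0[OF _ M p0 _ Jb \<open>2 ^ (k - 1) * l \<le> J\<close>])
      show "0 \<le> T (\<psi> x) \<and> T (\<psi> x) \<le> b" if "x \<in> {0..<int M}" for x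
        using T \<Gamma>(2) that by blast
    qed (use * k in \<open>auto simp: A_def s_def\<close>)
    then have "zero_sum_colored k \<psi> (\<lambda>i. (n + int i * d) mod int M)"
      unfolding zero_sum_colored_def using gen[of "\<lambda>i. \<psi> ((n + int i * d) mod int M)"] mem by blast
    then show "int M dvd d" by (rule \<psi>)
  qed
  finally show "\<rho> \<le> 1 / M + \<epsilon>" by simp
qed

section \<open>Existence of the greatest lower bound\<close>

lemma AP_lower_bound_0: "AP_lower_bound k \<alpha> 0"
  unfolding AP_lower_bound_def
proof (intro allI impI exI[of _ "1::real"] conjI exI[of _ "0::nat"])
  fix \<epsilon> :: real and N and A :: "int set" assume "\<epsilon> > 0"
  let ?G = "integer_mod_group N"
  have "(\<Prod>i<k. indicator A (n \<otimes>\<^bsub>?G\<^esub> d [^]\<^bsub>?G\<^esub> i) :: complex)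
      = of_real (\<Prod>i<k. indicator A (n \<otimes>\<^bsub>?G\<^esub> d [^]\<^bsub>?G\<^esub> i))" for n d :: int
  proof -
    have "complex_of_real (indicator A x) = indicator A x" for x by (cases "x \<in> A") auto
    then show ?thesis by (simp only: of_real_prod)
  qed
  then have "AP_average ?G k (indicator A) = average (carrier ?G \<times> carrier ?G)
      (\<lambda>nd. of_real (case nd of (n, d) \<Rightarrow> \<Prod>i<k. indicator A (n \<otimes>\<^bsub>?G\<^esub> d [^]\<^bsub>?G\<^esub> i)))"
    unfolding AP_average_def by (intro average_cong) auto
  also have "Re \<dots> \<ge> 0"
    unfolding average_of_real by (auto intro!: divide_nonneg_nonneg sum_nonneg prod_nonneg)
  finally show "0 - \<epsilon> \<le> Re (AP_average ?G k (indicator A))" using \<open>\<epsilon> > 0\<close> by simp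
qed simp

lemma AP_lower_bound_mono:
  assumes "AP_lower_bound k \<alpha> \<rho>" "\<rho>' \<le> \<rho>" shows "AP_lower_bound k \<alpha> \<rho>'"
  unfolding AP_lower_bound_def
proof (intro allI impI)
  fix \<epsilon> :: real assume "\<epsilon> > 0"
  with assms(1) obtain \<eta> N\<^sub>0 where *: "\<eta> > 0" "\<forall>N\<ge>N\<^sub>0. N \<ge> 1 \<longrightarrow>
        (\<forall>A \<subseteq> carrier (integer_mod_group N).
           gowers_norm (integer_mod_group N) (k - 2)
             (\<lambda>n. indicator A n - complex_of_real \<alpha>) \<le> \<eta> \<longrightarrow>
           Re (AP_average (integer_mod_group N) k (indicator A)) \<ge> \<rho> - \<epsilon>)"
    unfolding AP_lower_bound_def by meson
  then show "\<exists>\<eta>>0. \<exists>N\<^sub>0. \<forall>N\<ge>N\<^sub>0. N \<ge> 1 \<longrightarrow>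
        (\<forall>A \<subseteq> carrier (integer_mod_group N).
           gowers_norm (integer_mod_group N) (k - 2)
             (\<lambda>n. indicator A n - complex_of_real \<alpha>) \<le> \<eta> \<longrightarrow>
           Re (AP_average (integer_mod_group N) k (indicator A)) \<ge> \<rho>' - \<epsilon>)"
    using assms(2) by (intro exI[of _ \<eta>] conjI exI[of _ N\<^sub>0] allI impI) (auto intro: order_trans[of _ "\<rho> - \<epsilon>"])
qed

text \<open>Half of the tolerance pays for lowering the bound, so the supremum of valid bounds is
  itself valid.\<close>

lemma AP_lower_bound_approx:
  assumes "\<And>\<delta>. \<delta> > 0 \<Longrightarrow> AP_lower_bound k \<alpha> (\<rho> - \<delta>)" shows "AP_lower_bound k \<alpha> \<rho>"
  unfolding AP_lower_bound_def
proof (intro allI impI)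
  fix \<epsilon> :: real assume "\<epsilon> > 0"
  then have "\<epsilon> / 2 > 0" "\<rho> - \<epsilon> / 2 - \<epsilon> / 2 = \<rho> - \<epsilon>" by simp_all
  then show "\<exists>\<eta>>0. \<exists>N\<^sub>0. \<forall>N\<ge>N\<^sub>0. N \<ge> 1 \<longrightarrow>
        (\<forall>A \<subseteq> carrier (integer_mod_group N).
           gowers_norm (integer_mod_group N) (k - 2)
             (\<lambda>n. indicator A n - complex_of_real \<alpha>) \<le> \<eta> \<longrightarrow>
           Re (AP_average (integer_mod_group N) k (indicator A)) \<ge> \<rho> - \<epsilon>)"
    using assms[of "\<epsilon> / 2"] unfolding AP_lower_bound_def by metis
qed

text \<open>\<open>GREATEST\<close> is informative only if the maximum exists. The valid bounds
  contain 0, are bounded by \<open>b\<close> and include their supremum, so \<open>rho\<close>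
  equals that supremum.\<close>

lemma rho_le:
  assumes bound: "\<And>\<rho>. AP_lower_bound k \<alpha> \<rho> \<Longrightarrow> \<rho> \<le> b"
  shows "rho k \<alpha> \<le> b"
proof -
  define S where "S = {\<rho>. AP_lower_bound k \<alpha> \<rho>}"
  have S: "S \<noteq> {}" "bdd_above S"
    using AP_lower_bound_0 bound bdd_aboveI[of S b] by (auto simp: S_def)
  have "AP_lower_bound k \<alpha> (Sup S - \<delta>)" if \<delta>: "\<delta> > 0" for \<delta>
  proof -
    obtain \<rho> where "\<rho> \<in> S" "Sup S - \<delta> < \<rho>"
      using less_cSup_iff[OF S, of "Sup S - \<delta>"] \<delta> by auto
    then show ?thesis using AP_lower_bound_mono by (auto simp: S_def)
  qed
  then have "AP_lower_bound k \<alpha> (Sup S)" by (rule AP_lower_bound_approx)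
  then have "rho k \<alpha> = Sup S"
    unfolding rho_def by (rule Greatest_equality) (auto simp: S_def intro!: cSup_upper S(2)[unfolded S_def])
  also have "\<dots> \<le> b" using bound by (intro cSup_least S) (simp add: S_def)
  finally show ?thesis .
qed

section \<open>Choice of the parameters\<close>

theorem theorem1p15:
  fixes k :: nat and r :: "nat \<Rightarrow> nat"
  assumes "k \<ge> 4" and "even k"
    and "\<And>N. N \<ge> 1 \<Longrightarrow> r N \<ge> 1"
    and "(\<lambda>N. ln (real (r N)) / ln (real N)) \<longlonglongrightarrow> 0"
    and "\<And>N. N \<ge> 1 \<Longrightarrow>
           \<exists>c :: int \<Rightarrow> nat. c \<in> {1..int N} \<rightarrow> {1..r N} \<and> \<not> contains_sym_colored_AP k N c"
  shows "\<forall>C>0::real. \<forall>\<^sub>F \<alpha> in at_right 0. rho k \<alpha> < \<alpha> powr C"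
proof (intro allI impI)
  fix C :: real assume C: "C > 0"
  \<comment> \<open>\<open>D\<close> stays fixed while \<open>q\<close> grows like
    \<open>\<alpha> powr (-a)\<close>. The number of colors is of order \<open>q ^ 3\<close>, so its
    power \<open>k\<close> costs \<open>\<alpha> powr (- (3 * real k * a))\<close>, at most
    \<open>\<alpha> powr (-1/2)\<close> for this \<open>D\<close>.\<close>
  define D where "D = nat \<lceil>6 * real k * C\<rceil>"
  have D: "real D \<ge> 6 * real k * C" using C by (simp add: D_def)
  have "6 * real k * C > 0" using C assms(1) by simp
  then have D0: "D > 0" using D by linarith
  define a where "a = C / D"
  have a: "a > 0" using C D0 by (simp add: a_def)
  have ka: "3 * real k * a \<le> 1 / 2" using D D0 by (simp add: a_def field_simps)
  \<comment> \<open>With \<open>1 / D\<close> as threshold, \<open>r M\<close> falls below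
    \<open>M powr (1 / D)\<close>, which is \<open>q\<close>.\<close>
  have "eventually (\<lambda>N. ln (real (r N)) / ln (real N) < 1 / D) sequentially"
    using assms(4) D0 by (intro order_tendstoD(2)) auto
  then obtain M\<^sub>0 where M\<^sub>0: "\<And>N. N \<ge> M\<^sub>0 \<Longrightarrow> ln (real (r N)) / ln (real N) < 1 / D"
    by (auto simp: eventually_sequentially)
  define L where "L = real ((2 * k + 1) ^ (D + 1) * (D + 1))"
  define \<kappa> where "\<kappa> = 2 * fact k + (1 :: real)"
  define H where "H = (8 * L * \<kappa> ^ 3) ^ k"
  have H: "H \<ge> 0" by (simp add: H_def L_def \<kappa>_def)
  have "\<forall>\<^sub>F \<alpha>::real in at_right 0. \<alpha> powr (-a) \<ge> real M\<^sub>0"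
    using a by real_asymp
  moreover have "\<forall>\<^sub>F \<alpha>::real in at_right 0. H * \<alpha> powr (1/2) \<le> 1"
    by real_asymp
  moreover have "\<forall>\<^sub>F \<alpha>::real in at_right 0. 0 < \<alpha> \<and> \<alpha> < 1"
    using eventually_at_right_real[of 0 1] by simp
  ultimately show "\<forall>\<^sub>F \<alpha> in at_right 0. rho k \<alpha> < \<alpha> powr C"
  proof eventually_elim
    case (elim \<alpha>)
    then have \<alpha>: "0 < \<alpha>" "\<alpha> < 1" by auto
    define y where "y = \<alpha> powr (-a)"
    have "\<alpha> powr 0 \<le> \<alpha> powr (-a)" using \<alpha> a by (intro powr_mono') auto
    then have y1: "y \<ge> 1" using \<alpha> by (simp add: y_def)
    define m where "m = nat \<lceil>y\<rceil>"
    \<comment> \<open>One more than a multiple of \<open>fact k\<close>, hence coprime to every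
      index difference below \<open>k\<close>.\<close>
    define q where "q = fact k * m + 1"
    define M where "M = q ^ D"
    have m: "real m \<ge> y" "real m \<le> 2 * y" "m \<ge> 1" using y1 by (auto simp: m_def of_nat_nat) linarith+
    have "real m * 1 \<le> real m * fact k" by (intro mult_left_mono) auto
    then have qy: "real q > y" using m(1) by (simp add: q_def mult.commute)
    have "fact k * real m \<le> fact k * (2 * y)" using m(2) by (intro mult_left_mono) auto
    moreover have "real q = fact k * real m + 1" by (simp add: q_def)
    ultimately have "real q \<le> fact k * (2 * y) + y" using y1 by linarith
    then have q\<kappa>: "real q \<le> \<kappa> * y" by (simp add: \<kappa>_def algebra_simps)
    have "q \<ge> k"
    proof -
      have "k \<le> fact k * 1" by (simp add: fact_ge_self)
      also have "\<dots> \<le> fact k * m" using m(3) by (intro mult_left_mono) auto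
      finally show ?thesis by (simp add: q_def)
    qed
    have cop: "coprime j q" if "0 < j" "j < k" for j
    proof -
      have "j dvd fact k" using that by (intro dvd_fact) auto
      then have "j dvd fact k * m" by (rule dvd_mult2)
      then show ?thesis unfolding q_def
        by (metis coprime_1_right coprime_add_one_right coprime_divisors dvd_refl)
    qed
    have q1: "q > 1" using m(3) by (simp add: q_def)
    have "q ^ 1 \<le> q ^ D" using q1 D0 by (intro power_increasing) auto
    then have qM: "q \<le> M" by (simp add: M_def)
    then have M: "M \<ge> 1" "real M \<ge> real M\<^sub>0" using q1 qy elim(1) by (auto simp: y_def)
    then have "M \<ge> M\<^sub>0" by simp
    have rq: "r M \<le> q"
    proof -
      have "ln (real (r M)) / (real D * ln (real q)) < 1 / D"
        using M\<^sub>0[OF \<open>M \<ge> M\<^sub>0\<close>] q1 by (simp add: M_def ln_realpow)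
      then have "ln (real (r M)) < ln (real q)"
        using q1 D0 by (simp add: divide_simps)
      then show ?thesis using assms(3)[OF M(1)] q1 by simp
    qed
    obtain c :: "int \<Rightarrow> nat" where c: "c \<in> {1..int M} \<rightarrow> {1..r M}" "\<not> contains_sym_colored_AP k M c"
      using assms(5)[OF M(1)] by blast
    define \<psi> where "\<psi> = symmetric_free_color k q D c"
    define \<Gamma> where "\<Gamma> = {1..r M} \<times> {l. set l \<subseteq> {..2 * k} \<and> length l = D} \<times> {0..int D * (int q)\<^sup>2} \<times> {..2 * k}"
    have fin: "finite \<Gamma>" by (simp add: \<Gamma>_def finite_lists_length_eq)
    have "card \<Gamma> = r M * ((2 * k + 1) ^ D * ((D * q\<^sup>2 + 1) * (2 * k + 1)))"
      by (simp add: \<Gamma>_def card_cartesian_product card_lists_length_eq nat_add_distrib nat_mult_distrib nat_power_eq)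
    also have "\<dots> \<le> q * ((2 * k + 1) ^ D * (((D + 1) * q\<^sup>2) * (2 * k + 1)))"
      using rq q1 by (intro mult_mono) auto
    also have "\<dots> = (2 * k + 1) ^ (D + 1) * (D + 1) * q ^ 3"
      unfolding power_add power_one_right power2_eq_square power3_eq_cube by (simp only: mult_ac)
    finally have "real (card \<Gamma>) \<le> L * real q ^ 3"
      unfolding L_def by (metis of_nat_le_iff of_nat_mult of_nat_power)
    also have "\<dots> \<le> L * (\<kappa> * y) ^ 3"
      using q\<kappa> by (intro mult_left_mono power_mono) (auto simp: L_def)
    finally have card: "real (card \<Gamma>) \<le> L * \<kappa> ^ 3 * y ^ 3" by (simp add: power_mult_distrib)
    have "\<alpha> * (8 * real (card \<Gamma>)) ^ k \<le> \<alpha> * (8 * (L * \<kappa> ^ 3 * y ^ 3)) ^ k"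
      using card \<alpha> by (intro mult_left_mono power_mono) auto
    also have "\<dots> = H * (\<alpha> * (y ^ 3) ^ k)" by (simp add: H_def power_mult_distrib mult_ac)
    also have "(y ^ 3) ^ k = \<alpha> powr (- (3 * real k * a))"
      unfolding y_def using \<alpha> by (simp add: powr_power mult_ac flip: power_mult)
    also have "\<alpha> * \<alpha> powr (- (3 * real k * a)) = \<alpha> powr (1 - 3 * real k * a)"
      using \<alpha> by (simp add: powr_diff powr_minus_divide)
    also have "H * \<dots> \<le> H * \<alpha> powr (1/2)"
      using \<alpha> ka H by (intro mult_left_mono powr_mono') auto
    also have "\<dots> \<le> 1" by (rule elim(2))
    finally have \<alpha>\<Gamma>: "\<alpha> * (8 * real (card \<Gamma>)) ^ k \<le> 1" .
    have "rho k \<alpha> \<le> 1 / M"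
    proof (rule rho_le, rule AP_lower_bound_le[OF assms(1) _ fin _ _ \<alpha> \<alpha>\<Gamma>])
      show "\<psi> ` {0..<int M} \<subseteq> \<Gamma>"
        unfolding \<psi>_def \<Gamma>_def
        by (intro image_subsetI symmetric_free_color_mem)
           (use assms(1) \<open>q \<ge> k\<close> D0 c(1) in \<open>simp_all add: M_def\<close>)
      show "int M dvd d" if "zero_sum_colored k \<psi> (\<lambda>i. (n + int i * d) mod int M)" for n d
        using zero_sum_colored_imp_dvd[of k q D c n d] that assms(1,2) \<open>q \<ge> k\<close> D0 cop c(2)
        unfolding \<psi>_def M_def by auto
    qed (use M in auto)
    also have "1 / M < \<alpha> powr C"
    proof -
      \<comment> \<open>Here \<open>a * D = C\<close>, and \<open>q\<close> is strictly larger than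
        \<open>y\<close>, which gives the strict inequality.\<close>
      have "\<alpha> powr (- C) = y ^ D"
        unfolding y_def using \<alpha> D0 by (simp add: powr_power a_def)
      also have "\<dots> < real q ^ D" using qy y1 D0 by (intro power_strict_mono) auto
      finally have "1 / \<alpha> powr C < M" by (simp add: M_def powr_minus_divide)
      then show ?thesis using \<alpha> M by (simp add: field_simps)
    qed
    finally show "rho k \<alpha> < \<alpha> powr C" .
  qed
qed

end
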